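(* Let $T$ be an integral domain, $R$ a subring with identity, and $I=(R:T)$. Consider the sequence of group homomorphisms $$1\xrightarrow{\iota} U(R)\xrightarrow{\phi} U(T)\oplus U(R/I)\xrightarrow{\psi} U(T/I)\xrightarrow{\sigma} \mathrm{Cl}(R)\xrightarrow{\tau}\mathrm{Cl}(T)\xrightarrow{\pi}1$$ where $\phi(v)=(v,v^{-1}+I)$, $\psi(u,r+I)=ur+I$, $\sigma(t+I)=[tT\cap R]$ (with a nonzero representative $t$), $\tau([J])=[JT]$, and $\iota,\pi$ are the trivial maps. If this whole sequence is exact (in particular, if every ideal class in $\ker(\tau)$ contains an ideal class representative which is an integral ideal of $R$ comaximal to $I$ and every ideal class in $\mathrm{Cl}(T)$ contains an ideal class representative which is an integral ideal of $T$ comaximal to $I$), then the following are equivalent: (1) $R$ is a locally associated subring of $T$; (2) $\mathrm{Cl}(R)\cong \mathrm{Cl}(T)$ via the isomorphism $\tau$ (that is, $\tau$ is an isomorphism).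
   Context: $U(A)$ denotes the group of units of a commutative ring $A$ with identity. The conductor is $(R:T)=\{r\in R : rT\subseteq R\}$; it is an ideal of both $R$ and $T$. For an integral domain $D$, $\mathrm{Cl}(D)$ is the group of invertible fractional ideals of $D$ modulo the subgroup of principal fractional ideals (the Picard group), and $[J]$ denotes the class of $J$. An integral ideal of $D$ is a fractional ideal contained in $D$. An ideal $J$ of $R$ (resp. of $T$) is comaximal to $I$ if $J+I=R$ (resp. $J+I=T$). $R$ is a locally associated subring of $T$ if for every $t\in T$ with $tT+I=T$ there exist $r\in R$ with $rR+I=R$ and $u\in U(T)$ such that $t=ru$, where $I=(R:T)$. *)

theory Defs
  imports "HOL-Algebra.Algebra"
begin

section \<open>Quotient fields, fractional ideals and class groups\<close>

text \<open>A subring \<open>R\<close> of a ring \<open>T\<close> is a set with \<open>subring R T\<close>; the corresponding ring is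
  \<open>T\<lparr>carrier := R\<rparr>\<close>, and in particular \<open>U(R)\<close> is \<open>units_of (T\<lparr>carrier := R\<rparr>)\<close>.\<close>

definition fractions :: "'a ring \<Rightarrow> 'a set \<Rightarrow> 'a set" where
  "fractions K D = {a \<otimes>\<^bsub>K\<^esub> inv\<^bsub>K\<^esub> b | a b. a \<in> D \<and> b \<in> D - {\<zero>\<^bsub>K\<^esub>}}"

text \<open>As usual, a domain is regarded as a subset of its quotient field. Record equality makes the
  operations of \<open>T\<close> those of \<open>K\<close>.\<close>

definition is_quotient_field :: "'a ring \<Rightarrow> 'a ring \<Rightarrow> bool" where
  "is_quotient_field K T \<longleftrightarrow>
     field K \<and> subring (carrier T) K \<and> T = K\<lparr>carrier := carrier T\<rparr> \<and>
     carrier K = fractions K (carrier T)"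

text \<open>In the following, \<open>D\<close> is a subring of the field \<open>K\<close>. The quotient field of \<open>D\<close> is
  \<open>fractions K D\<close>, which may be smaller than \<open>K\<close>.\<close>

definition fractional_ideal :: "'a ring \<Rightarrow> 'a set \<Rightarrow> 'a set \<Rightarrow> bool" where
  "fractional_ideal K D J \<longleftrightarrow>
     J \<subseteq> fractions K D \<and> subgroup J (add_monoid K) \<and>
     (\<forall>d\<in>D. \<forall>x\<in>J. d \<otimes>\<^bsub>K\<^esub> x \<in> J) \<and>
     (\<exists>d\<in>D - {\<zero>\<^bsub>K\<^esub>}. \<forall>x\<in>J. d \<otimes>\<^bsub>K\<^esub> x \<in> D)"

text \<open>For additive subgroups \<open>J\<close>, \<open>L\<close> of \<open>K\<close>, \<open>ideal_prod K J L\<close> is the set of finite sums of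
  products, i.e. the usual product \<open>JL\<close>. It also serves as the extension \<open>JT\<close>.\<close>

definition invertible_ideal :: "'a ring \<Rightarrow> 'a set \<Rightarrow> 'a set \<Rightarrow> bool" where
  "invertible_ideal K D J \<longleftrightarrow>
     fractional_ideal K D J \<and> (\<exists>L. fractional_ideal K D L \<and> ideal_prod K J L = D)"

definition invertible_ideals :: "'a ring \<Rightarrow> 'a set \<Rightarrow> 'a set monoid" where
  "invertible_ideals K D =
     \<lparr>carrier = {J. invertible_ideal K D J}, monoid.mult = ideal_prod K, one = D\<rparr>"

definition principal_ideals :: "'a ring \<Rightarrow> 'a set \<Rightarrow> 'a set set" where
  "principal_ideals K D =
     {PIdl\<^bsub>K\<lparr>carrier := D\<rparr>\<^esub> x | x. x \<in> fractions K D - {\<zero>\<^bsub>K\<^esub>}}"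

definition Cl :: "'a ring \<Rightarrow> 'a set \<Rightarrow> 'a set set monoid" where
  "Cl K D = invertible_ideals K D Mod principal_ideals K D"

definition ideal_class :: "'a ring \<Rightarrow> 'a set \<Rightarrow> 'a set \<Rightarrow> 'a set set" where
  "ideal_class K D J = principal_ideals K D #>\<^bsub>invertible_ideals K D\<^esub> J"


section \<open>Conductor and locally associated subrings\<close>

definition conductor :: "'a ring \<Rightarrow> 'a set \<Rightarrow> 'a set" where
  "conductor T R = {r \<in> R. \<forall>t\<in>carrier T. r \<otimes>\<^bsub>T\<^esub> t \<in> R}"

definition comaximal :: "'a ring \<Rightarrow> 'a set \<Rightarrow> 'a set \<Rightarrow> bool" where
  "comaximal A J I \<longleftrightarrow> J <+>\<^bsub>A\<^esub> I = carrier A"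

definition locally_associated_subring :: "'a ring \<Rightarrow> 'a set \<Rightarrow> bool" where
  "locally_associated_subring T R \<longleftrightarrow>
     (\<forall>t\<in>carrier T. comaximal T (PIdl\<^bsub>T\<^esub> t) (conductor T R) \<longrightarrow>
        (\<exists>r\<in>R. comaximal (T\<lparr>carrier := R\<rparr>) (PIdl\<^bsub>T\<lparr>carrier := R\<rparr>\<^esub> r) (conductor T R) \<and>
           (\<exists>u\<in>Units T. t = r \<otimes>\<^bsub>T\<^esub> u)))"


section \<open>The sequence\<close>

text \<open>The maps out of quotients are given by evaluating on
  all admissible representatives and taking the unique resulting value.\<close>

abbreviation units_quot :: "'a ring \<Rightarrow> 'a set \<Rightarrow> 'a set monoid" where
  "units_quot A I \<equiv> units_of (A Quot I)"

definition seq_iota :: "'a ring \<Rightarrow> unit \<Rightarrow> 'a" where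
  "seq_iota T = (\<lambda>_. \<one>\<^bsub>T\<^esub>)"

definition seq_phi :: "'a ring \<Rightarrow> 'a set \<Rightarrow> 'a \<Rightarrow> 'a \<times> 'a set" where
  "seq_phi T R v =
     (v, conductor T R +>\<^bsub>T\<lparr>carrier := R\<rparr>\<^esub> inv\<^bsub>T\<lparr>carrier := R\<rparr>\<^esub> v)"

definition seq_psi :: "'a ring \<Rightarrow> 'a set \<Rightarrow> 'a \<times> 'a set \<Rightarrow> 'a set" where
  "seq_psi T R = (\<lambda>(u, Y). the_elem ((\<lambda>r. conductor T R +>\<^bsub>T\<^esub> (u \<otimes>\<^bsub>T\<^esub> r)) ` Y))"

definition seq_sigma :: "'a ring \<Rightarrow> 'a ring \<Rightarrow> 'a set \<Rightarrow> 'a set \<Rightarrow> 'a set set" where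
  "seq_sigma K T R Y =
     the_elem ((\<lambda>t. ideal_class K R ((PIdl\<^bsub>T\<^esub> t) \<inter> R)) ` (Y - {\<zero>\<^bsub>T\<^esub>}))"

definition seq_tau :: "'a ring \<Rightarrow> 'a ring \<Rightarrow> 'a set set \<Rightarrow> 'a set set" where
  "seq_tau K T C =
     the_elem ((\<lambda>J. ideal_class K (carrier T) (ideal_prod K J (carrier T))) ` C)"

definition seq_pi :: "'a set set \<Rightarrow> unit" where
  "seq_pi = (\<lambda>_. ())"

text \<open>The maps take the prescribed values, independently of representatives.\<close>

definition seq_well_defined :: "'a ring \<Rightarrow> 'a ring \<Rightarrow> 'a set \<Rightarrow> bool" where
  "seq_well_defined K T R \<longleftrightarrow>
     (let S = T\<lparr>carrier := R\<rparr>; I = conductor T R in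
       (\<forall>u\<in>Units T. \<forall>r\<in>R. I +>\<^bsub>S\<^esub> r \<in> Units (S Quot I) \<longrightarrow>
          seq_psi T R (u, I +>\<^bsub>S\<^esub> r) = I +>\<^bsub>T\<^esub> (u \<otimes>\<^bsub>T\<^esub> r)) \<and>
       (\<forall>t\<in>carrier T - {\<zero>\<^bsub>T\<^esub>}. I +>\<^bsub>T\<^esub> t \<in> Units (T Quot I) \<longrightarrow>
          seq_sigma K T R (I +>\<^bsub>T\<^esub> t) = ideal_class K R ((PIdl\<^bsub>T\<^esub> t) \<inter> R)) \<and>
       (\<forall>J. invertible_ideal K R J \<longrightarrow>
          seq_tau K T (ideal_class K R J)
            = ideal_class K (carrier T) (ideal_prod K J (carrier T))))"

definition seq_homs :: "'a ring \<Rightarrow> 'a ring \<Rightarrow> 'a set \<Rightarrow> bool" where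
  "seq_homs K T R \<longleftrightarrow>
     (let S = T\<lparr>carrier := R\<rparr>; I = conductor T R in
       group_hom (singleton_group ()) (units_of S) (seq_iota T) \<and>
       group_hom (units_of S) (units_of T \<times>\<times> units_quot S I) (seq_phi T R) \<and>
       group_hom (units_of T \<times>\<times> units_quot S I) (units_quot T I) (seq_psi T R) \<and>
       group_hom (units_quot T I) (Cl K R) (seq_sigma K T R) \<and>
       group_hom (Cl K R) (Cl K (carrier T)) (seq_tau K T) \<and>
       group_hom (Cl K (carrier T)) (singleton_group ()) seq_pi)"

text \<open>The library's \<open>exact_seq\<close> requires all groups to have elements of the same type.\<close>

definition seq_exact :: "'a ring \<Rightarrow> 'a ring \<Rightarrow> 'a set \<Rightarrow> bool" where
  "seq_exact K T R \<longleftrightarrow>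
     (let S = T\<lparr>carrier := R\<rparr>; I = conductor T R in
       seq_iota T ` carrier (singleton_group ())
         = kernel (units_of S) (units_of T \<times>\<times> units_quot S I) (seq_phi T R) \<and>
       seq_phi T R ` carrier (units_of S)
         = kernel (units_of T \<times>\<times> units_quot S I) (units_quot T I) (seq_psi T R) \<and>
       seq_psi T R ` carrier (units_of T \<times>\<times> units_quot S I)
         = kernel (units_quot T I) (Cl K R) (seq_sigma K T R) \<and>
       seq_sigma K T R ` carrier (units_quot T I)
         = kernel (Cl K R) (Cl K (carrier T)) (seq_tau K T) \<and>
       seq_tau K T ` carrier (Cl K R)
         = kernel (Cl K (carrier T)) (singleton_group ()) seq_pi)"

end

theory Submission
  imports Defs
begin

text \<open>
  Write \<open>B\<close> for the carrier of \<open>T\<close>, \<open>K\<close> for its quotient field, and call \<open>t\<close> a unit modulo \<open>I\<close> if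
  \<open>ts + i = 1\<close> for some \<open>s\<close> and some \<open>i \<in> I\<close>. Everything rests on the contraction \<open>tB \<inter> R\<close> of a
  principal ideal of \<open>T\<close> generated by such a \<open>t\<close>.

  Since \<open>I\<close> is an ideal of \<open>T\<close> contained in \<open>R\<close>, multiplying by \<open>i\<close> moves elements of \<open>T\<close> into \<open>R\<close>,
  and \<open>ts = 1 - i\<close> lies in \<open>R\<close>. Splitting \<open>1\<close> in this way shows that contraction is multiplicative
  (\<open>contraction_mult\<close>), that \<open>eB \<inter> R = eR\<close> when \<open>e \<in> R\<close> is a unit modulo \<open>I\<close> in \<open>R\<close>
  (\<open>contraction_of_R\<close>), and that \<open>(tB \<inter> R)B = tB\<close> (\<open>ext_contraction\<close>). Hence
  \<open>(tB \<inter> R)(sB \<inter> R) = tsR\<close> is principal, so \<open>tB \<inter> R\<close> is invertible and its class is inverse to that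
  of \<open>sB \<inter> R\<close>. If \<open>t'\<close> is congruent to \<open>t\<close> modulo \<open>I\<close>, the same \<open>s\<close> serves for \<open>t'\<close>, so the class depends
  only on the coset of \<open>t\<close> and \<open>\<sigma>\<close> is a well-defined homomorphism. For \<open>t \<noteq> 0\<close> the class is trivial exactly when
  \<open>t = ur\<close> with \<open>u\<close> a unit of \<open>T\<close> and \<open>r \<in> R\<close> a unit modulo \<open>I\<close> in \<open>R\<close> (\<open>contraction_principal_iff\<close>): a
  generator \<open>r\<close> of \<open>tB \<inter> R\<close> satisfies \<open>rB = tB\<close>. This is exactness at \<open>U(T/I)\<close>.

  Exactness at the class groups needs the comaximal representatives. If \<open>J \<subseteq> R\<close> is comaximal to \<open>I\<close>,
  then \<open>J = JB \<inter> R\<close>; so \<open>J\<close> is a contracted principal ideal as soon as \<open>JB\<close> is principal. If \<open>L\<close>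
  is an invertible ideal of \<open>T\<close> comaximal to \<open>I\<close> with inverse \<open>M\<close>, then \<open>L \<inter> R\<close> has inverse \<open>R + MI\<close>
  and extends to \<open>L\<close>, so the class of \<open>L\<close> is in the image of \<open>\<tau>\<close>.

  Finally, exactness makes \<open>\<tau>\<close> surjective with kernel the set of classes of contracted ideals
  \<open>tB \<inter> R\<close>. So \<open>\<tau>\<close> is an isomorphism iff all these classes are trivial, that is, iff every nonzero
  unit \<open>t\<close> modulo \<open>I\<close> is a product \<open>ur\<close> as above; this is the definition of a locally associated
  subring. The element \<open>t = 0\<close> is a unit modulo \<open>I\<close> only if \<open>1 \<in> I\<close>, where \<open>0 = 1 \<cdot> 0\<close> is such a
  product.
\<close>

section \<open>Products of subsets of a commutative ring\<close>

lemma ideal_prod_least: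
  assumes "\<And>a b. \<lbrakk>a \<in> A; b \<in> B\<rbrakk> \<Longrightarrow> a \<otimes>\<^bsub>G\<^esub> b \<in> C"
    and "\<And>x y. \<lbrakk>x \<in> C; y \<in> C\<rbrakk> \<Longrightarrow> x \<oplus>\<^bsub>G\<^esub> y \<in> C"
  shows "ideal_prod G A B \<subseteq> C"
proof
  fix x assume "x \<in> ideal_prod G A B"
  then show "x \<in> C" by induct (use assms in auto)
qed

lemma ideal_prod_mono:
  assumes "A \<subseteq> A'" "B \<subseteq> B'"
  shows "ideal_prod G A B \<subseteq> ideal_prod G A' B'"
  by (rule ideal_prod_least) (use assms in \<open>auto intro: ideal_prod.intros\<close>)

context cring
begin

lemma ideal_prod_closed:
  assumes "A \<subseteq> carrier R" "B \<subseteq> carrier R"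
  shows "A \<cdot> B \<subseteq> carrier R"
  by (rule ideal_prod_least) (use assms in auto)

lemma ideal_prod_comm:
  assumes "A \<subseteq> carrier R" "B \<subseteq> carrier R"
  shows "A \<cdot> B = B \<cdot> A"
proof -
  have *: "A \<cdot> B \<subseteq> B \<cdot> A" if "A \<subseteq> carrier R" "B \<subseteq> carrier R" for A B
  proof (rule ideal_prod_least)
    fix a b assume ab: "a \<in> A" "b \<in> B"
    then have "a \<otimes> b = b \<otimes> a" using that by (intro m_comm) auto
    then show "a \<otimes> b \<in> B \<cdot> A" using ab by (simp add: ideal_prod.prod)
  qed (rule ideal_prod.sum)
  show ?thesis using * assms by blast
qed

lemma ideal_prod_assoc:
  assumes "A \<subseteq> carrier R" "B \<subseteq> carrier R" "C \<subseteq> carrier R"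
  shows "(A \<cdot> B) \<cdot> C = A \<cdot> (B \<cdot> C)"
proof -
  have *: "(A \<cdot> B) \<cdot> C \<subseteq> A \<cdot> (B \<cdot> C)"
    if A: "A \<subseteq> carrier R" and B: "B \<subseteq> carrier R" and C: "C \<subseteq> carrier R" for A B C
  proof (rule ideal_prod_least)
    fix x c assume "x \<in> A \<cdot> B" and c: "c \<in> C"
    then show "x \<otimes> c \<in> A \<cdot> (B \<cdot> C)"
    proof (induct rule: ideal_prod.induct)
      case (prod a b)
      then have "a \<otimes> b \<otimes> c = a \<otimes> (b \<otimes> c)" using A B C by (simp add: m_assoc subset_iff)
      then show ?case using prod c by (auto intro: ideal_prod.intros)
    next
      case (sum s s')
      then have "(s \<oplus> s') \<otimes> c = s \<otimes> c \<oplus> s' \<otimes> c"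
        using ideal_prod_closed[OF A B] C c by (simp add: l_distr subset_iff)
      then show ?case using sum by (auto intro: ideal_prod.sum)
    qed
  qed (auto intro: ideal_prod.sum)
  show ?thesis
  proof
    have "A \<cdot> (B \<cdot> C) = (C \<cdot> B) \<cdot> A"
      using assms by (simp add: ideal_prod_comm ideal_prod_closed)
    also have "\<dots> \<subseteq> C \<cdot> (B \<cdot> A)" using assms by (intro *)
    also have "\<dots> = (A \<cdot> B) \<cdot> C"
      using assms by (simp add: ideal_prod_comm ideal_prod_closed)
    finally show "A \<cdot> (B \<cdot> C) \<subseteq> (A \<cdot> B) \<cdot> C" .
  qed (use * assms in blast)
qed

lemma ideal_prod_subgroup:
  assumes A: "subgroup A (add_monoid R)" and B: "subgroup B (add_monoid R)"
  shows "subgroup (A \<cdot> B) (add_monoid R)"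
proof -
  have Ac: "A \<subseteq> carrier R" and Bc: "B \<subseteq> carrier R"
    using subgroup.subset[OF A] subgroup.subset[OF B] by auto
  have ne: "A \<cdot> B \<noteq> {}"
    using ideal_prod.prod[of "\<zero>" A "\<zero>" B R]
      subgroup.one_closed[OF A] subgroup.one_closed[OF B] by auto
  have neg: "\<ominus> x \<in> A \<cdot> B" if "x \<in> A \<cdot> B" for x
    using that
  proof (induct rule: ideal_prod.induct)
    case (prod a b)
    then have "\<ominus> (a \<otimes> b) = (\<ominus> a) \<otimes> b" using Ac Bc by (simp add: l_minus subset_iff)
    moreover have "\<ominus> a \<in> A" using subgroup.m_inv_closed[OF A] prod by (simp add: a_inv_def)
    ultimately show ?case using prod by (auto intro: ideal_prod.intros)
  next
    case (sum s s')
    then have "\<ominus> (s \<oplus> s') = \<ominus> s \<oplus> \<ominus> s'"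
      using ideal_prod_closed[OF Ac Bc] by (simp add: minus_add subset_iff)
    then show ?case using sum by (auto intro: ideal_prod.sum)
  qed
  show ?thesis
    by (rule add.subgroupI)
      (use ideal_prod_closed[OF Ac Bc] ne neg in \<open>auto intro: ideal_prod.sum\<close>)
qed

end

section \<open>The class group of a subring of a field\<close>

locale field_subring = field K for K :: "'a ring" (structure) +
  fixes D :: "'a set"
  assumes subring: "subring D K"
begin

lemmas D = subringE[OF subring]

lemma D_carr [simp]: "x \<in> D \<Longrightarrow> x \<in> carrier K"
  using D(1) by auto

lemma D_nonzero_mult:
  assumes "b \<in> D - {\<zero>}" "d \<in> D - {\<zero>}"
  shows "b \<otimes> d \<in> D - {\<zero>}"
  using assms D(6) integral_iff by auto

lemma fractions_iff:
  "x \<in> fractions K D \<longleftrightarrow> x \<in> carrier K \<and> (\<exists>d\<in>D - {\<zero>}. d \<otimes> x \<in> D)"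
proof
  assume "x \<in> fractions K D"
  then obtain a b where ab: "a \<in> D" "b \<in> D - {\<zero>}" "x = a \<otimes> inv b"
    unfolding fractions_def by auto
  then have b: "b \<in> Units K" by (simp add: field_Units)
  then have "b \<otimes> x = a"
    using ab by (simp add: m_lcomm[of b a] Units_closed)
  then have "b \<otimes> x \<in> D" and xc: "x \<in> carrier K" using ab b by simp_all
  then show "x \<in> carrier K \<and> (\<exists>d\<in>D - {\<zero>}. d \<otimes> x \<in> D)"
    using xc ab(2) by blast
next
  assume "x \<in> carrier K \<and> (\<exists>d\<in>D - {\<zero>}. d \<otimes> x \<in> D)"
  then obtain d where d: "x \<in> carrier K" "d \<in> D - {\<zero>}" "d \<otimes> x \<in> D" by auto
  then have u: "d \<in> Units K" by (simp add: field_Units)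
  then have "x = (d \<otimes> x) \<otimes> inv d"
    using d by (simp add: m_comm[of d x] m_assoc Units_closed)
  then show "x \<in> fractions K D"
    using d unfolding fractions_def by blast
qed

lemma fractionsI: "\<lbrakk>x \<in> carrier K; d \<in> D - {\<zero>}; d \<otimes> x \<in> D\<rbrakk> \<Longrightarrow> x \<in> fractions K D"
  unfolding fractions_iff by blast

lemma fractions_mult:
  assumes "x \<in> fractions K D" "y \<in> fractions K D"
  shows "x \<otimes> y \<in> fractions K D"
proof -
  obtain b d where bd: "b \<in> D - {\<zero>}" "b \<otimes> x \<in> D" "d \<in> D - {\<zero>}" "d \<otimes> y \<in> D"
    and xy: "x \<in> carrier K" "y \<in> carrier K"
    using assms by (auto simp: fractions_iff)
  have "(b \<otimes> d) \<otimes> (x \<otimes> y) = (b \<otimes> x) \<otimes> (d \<otimes> y)"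
    using bd xy by (simp add: m_ac)
  then show ?thesis
    using D(6)[OF bd(2,4)] xy by (intro fractionsI[OF _ D_nonzero_mult[OF bd(1,3)]]) auto
qed

lemma fractions_inv:
  assumes "x \<in> fractions K D - {\<zero>}"
  shows "inv x \<in> fractions K D - {\<zero>}"
proof -
  obtain d where d: "d \<in> D - {\<zero>}" "d \<otimes> x \<in> D" and x: "x \<in> carrier K" "x \<noteq> \<zero>"
    using assms by (auto simp: fractions_iff)
  have u: "x \<in> Units K" using x by (simp add: field_Units)
  then have "(d \<otimes> x) \<otimes> inv x = d" using d x by (simp add: m_assoc)
  moreover have "d \<otimes> x \<noteq> \<zero>" using d x by (simp add: integral_iff)
  moreover have "inv x \<noteq> \<zero>" using u x by (metis Units_r_inv r_null zero_not_one)
  ultimately show ?thesis using d u fractionsI[of "inv x" "d \<otimes> x"] by simp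
qed

lemma one_fractions: "\<one> \<in> fractions K D - {\<zero>}"
  using D(3) by (auto simp: fractions_iff intro!: bexI[of _ \<one>])

text \<open>A common denominator \<open>d\<close> writes every \<open>x \<in> J\<close> as \<open>dx/d\<close>, so it already forces \<open>J\<close> to lie in the
  quotient field.\<close>

lemma fractional_ideal_iff:
  "fractional_ideal K D J \<longleftrightarrow> subgroup J (add_monoid K) \<and>
     (\<forall>d\<in>D. \<forall>x\<in>J. d \<otimes> x \<in> J) \<and> (\<exists>d\<in>D - {\<zero>}. \<forall>x\<in>J. d \<otimes> x \<in> D)"
proof -
  have "J \<subseteq> fractions K D" if "subgroup J (add_monoid K)" "\<exists>d\<in>D - {\<zero>}. \<forall>x\<in>J. d \<otimes> x \<in> D"
  proof -
    have "J \<subseteq> carrier K" using subgroup.subset[OF that(1)] by simp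
    then show ?thesis using that(2) fractionsI by blast
  qed
  then show ?thesis unfolding fractional_ideal_def by blast
qed

lemma fractional_ideal_carr: "fractional_ideal K D J \<Longrightarrow> J \<subseteq> carrier K"
  using subgroup.subset by (fastforce simp: fractional_ideal_iff)

lemma fractional_ideal_add:
  "\<lbrakk>fractional_ideal K D J; x \<in> J; y \<in> J\<rbrakk> \<Longrightarrow> x \<oplus> y \<in> J"
  using subgroup.m_closed by (fastforce simp: fractional_ideal_iff)

text \<open>The product of two common denominators is a common denominator of the product.\<close>

lemma fractional_ideal_prod:
  assumes J: "fractional_ideal K D J" and L: "fractional_ideal K D L"
  shows "fractional_ideal K D (J \<cdot> L)"
proof -
  note carr = fractional_ideal_carr[OF J] fractional_ideal_carr[OF L]
  have c: "J \<cdot> L \<subseteq> carrier K" using carr by (rule ideal_prod_closed)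
  obtain b d where bd: "b \<in> D - {\<zero>}" "\<forall>x\<in>J. b \<otimes> x \<in> D" "d \<in> D - {\<zero>}" "\<forall>x\<in>L. d \<otimes> x \<in> D"
    using J L unfolding fractional_ideal_iff by blast
  have m: "r \<otimes> x \<in> J \<cdot> L" if r: "r \<in> D" and "x \<in> J \<cdot> L" for r x
    using that(2)
  proof (induct rule: ideal_prod.induct)
    case (prod j l)
    then have "r \<otimes> (j \<otimes> l) = (r \<otimes> j) \<otimes> l" using carr r by (simp add: m_assoc subset_iff)
    moreover have "r \<otimes> j \<in> J" using J r prod unfolding fractional_ideal_iff by blast
    ultimately show ?case using prod by (auto intro: ideal_prod.intros)
  next
    case (sum s s')
    then have "r \<otimes> (s \<oplus> s') = r \<otimes> s \<oplus> r \<otimes> s'" using c r by (simp add: r_distr subset_iff)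
    then show ?case using sum by (auto intro: ideal_prod.intros)
  qed
  have den: "(b \<otimes> d) \<otimes> x \<in> D" if "x \<in> J \<cdot> L" for x
    using that
  proof (induct rule: ideal_prod.induct)
    case (prod j l)
    then have "j \<in> carrier K" "l \<in> carrier K" using carr by auto
    then have "(b \<otimes> d) \<otimes> (j \<otimes> l) = (b \<otimes> j) \<otimes> (d \<otimes> l)"
      using bd(1,3) by (simp add: m_ac)
    then show ?case using prod bd D(6) by auto
  next
    case (sum s s')
    then have "s \<in> carrier K" "s' \<in> carrier K" using c by auto
    then have "(b \<otimes> d) \<otimes> (s \<oplus> s') = (b \<otimes> d) \<otimes> s \<oplus> (b \<otimes> d) \<otimes> s'"
      using bd(1,3) by (simp add: r_distr)
    then show ?case using sum D(7) by auto
  qed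
  show ?thesis
    unfolding fractional_ideal_iff
  proof (intro conjI ballI bexI)
    show "subgroup (J \<cdot> L) (add_monoid K)"
      by (rule ideal_prod_subgroup) (use J L in \<open>simp_all add: fractional_ideal_iff\<close>)
  qed (use m den D_nonzero_mult[OF bd(1,3)] in simp_all)
qed

lemma ideal_prod_D:
  assumes J: "fractional_ideal K D J"
  shows "J \<cdot> D = J" "D \<cdot> J = J"
proof -
  have c: "J \<subseteq> carrier K" by (rule fractional_ideal_carr[OF J])
  show "D \<cdot> J = J"
  proof
    show "D \<cdot> J \<subseteq> J"
      by (rule ideal_prod_least)
        (use J fractional_ideal_add[OF J] in \<open>auto simp: fractional_ideal_iff\<close>)
    show "J \<subseteq> D \<cdot> J"
    proof
      fix x assume "x \<in> J"
      then show "x \<in> D \<cdot> J" using ideal_prod.prod[OF D(3), of x J K] c by auto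
    qed
  qed
  then show "J \<cdot> D = J" using ideal_prod_comm c D(1) by auto
qed

lemma fractional_ideal_D: "fractional_ideal K D D"
  unfolding fractional_ideal_iff
proof (intro conjI ballI bexI)
  show "\<one> \<in> D - {\<zero>}" using D(3) by simp
qed (use subring.axioms(1)[OF subring] D(6) in simp_all)

abbreviation principal :: "'a \<Rightarrow> 'a set"
  where "principal x \<equiv> PIdl\<^bsub>K\<lparr>carrier := D\<rparr>\<^esub> x"

lemma principal_eq: "principal x = (\<lambda>d. d \<otimes> x) ` D"
  by (auto simp: cgenideal_def)

lemma principal_self: "x \<in> carrier K \<Longrightarrow> x \<in> principal x"
  unfolding principal_eq using D(3) by (intro image_eqI[of _ _ \<one>]) simp_all

lemma principal_prod:
  assumes x: "x \<in> carrier K" and J: "fractional_ideal K D J"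
  shows "principal x \<cdot> J = (\<lambda>j. x \<otimes> j) ` J"
proof
  have c: "J \<subseteq> carrier K" by (rule fractional_ideal_carr[OF J])
  show "principal x \<cdot> J \<subseteq> (\<lambda>j. x \<otimes> j) ` J"
  proof (rule ideal_prod_least)
    fix a b assume "a \<in> principal x" and b: "b \<in> J"
    then obtain d where d: "d \<in> D" "a = d \<otimes> x" unfolding principal_eq by auto
    have "a \<otimes> b = x \<otimes> (d \<otimes> b)" using d b c x by (simp add: m_ac subset_iff)
    moreover have "d \<otimes> b \<in> J" using J d b unfolding fractional_ideal_iff by blast
    ultimately show "a \<otimes> b \<in> (\<lambda>j. x \<otimes> j) ` J" by (rule image_eqI)
  next
    fix a b assume "a \<in> (\<lambda>j. x \<otimes> j) ` J" "b \<in> (\<lambda>j. x \<otimes> j) ` J"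
    then obtain i j where ij: "i \<in> J" "j \<in> J" "a = x \<otimes> i" "b = x \<otimes> j" by auto
    then have "a \<oplus> b = x \<otimes> (i \<oplus> j)" using c x by (simp add: r_distr subset_iff)
    moreover have "i \<oplus> j \<in> J" by (rule fractional_ideal_add[OF J ij(1,2)])
    ultimately show "a \<oplus> b \<in> (\<lambda>j. x \<otimes> j) ` J" by (rule image_eqI)
  qed
  show "(\<lambda>j. x \<otimes> j) ` J \<subseteq> principal x \<cdot> J"
    using ideal_prod.prod[OF principal_self[OF x]] by (rule image_subsetI)
qed

lemma fractional_ideal_principal:
  assumes "x \<in> fractions K D"
  shows "fractional_ideal K D (principal x)"
proof -
  obtain b where b: "b \<in> D - {\<zero>}" "b \<otimes> x \<in> D" and x: "x \<in> carrier K"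
    using assms by (auto simp: fractions_iff)
  have 1: "d \<otimes> x \<oplus> d' \<otimes> x \<in> principal x" if "d \<in> D" "d' \<in> D" for d d'
    unfolding principal_eq by (rule image_eqI[of _ _ "d \<oplus> d'"]) (use that x D(7) in \<open>simp_all add: l_distr\<close>)
  have 2: "\<ominus> (d \<otimes> x) \<in> principal x" if "d \<in> D" for d
    unfolding principal_eq by (rule image_eqI[of _ _ "\<ominus> d"]) (use that x D(5) in \<open>simp_all add: l_minus\<close>)
  have 3: "a \<otimes> (d \<otimes> x) \<in> principal x" if "a \<in> D" "d \<in> D" for a d
    unfolding principal_eq by (rule image_eqI[of _ _ "a \<otimes> d"]) (use that x D(6) in \<open>simp_all add: m_assoc\<close>)
  have 4: "b \<otimes> (d \<otimes> x) \<in> D" if "d \<in> D" for d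
    using that x b D(6)[of d "b \<otimes> x"] by (simp add: m_lcomm)
  show ?thesis
    unfolding fractional_ideal_iff
  proof (intro conjI ballI bexI)
    show "subgroup (principal x) (add_monoid K)"
    proof (rule add.subgroupI)
      show "principal x \<subseteq> carrier K" "principal x \<noteq> {}" using x D(4) by (auto simp: principal_eq)
      show "\<ominus> a \<in> principal x" if "a \<in> principal x" for a using that 2 unfolding principal_eq by blast
      show "a \<oplus> b \<in> principal x" if "a \<in> principal x" "b \<in> principal x" for a b
        using that 1 unfolding principal_eq by blast
    qed
    show "d \<otimes> y \<in> principal x" if "d \<in> D" "y \<in> principal x" for d y
      using 3 that unfolding principal_eq by blast
    show "b \<otimes> y \<in> D" if "y \<in> principal x" for y
      using 4 that unfolding principal_eq by blast
  qed (use b(1) in simp_all)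
qed

lemma principal_mult:
  assumes x: "x \<in> carrier K" and y: "y \<in> fractions K D"
  shows "principal x \<cdot> principal y = principal (x \<otimes> y)"
proof -
  have y': "y \<in> carrier K" using y by (simp add: fractions_iff)
  have "x \<otimes> (d \<otimes> y) = d \<otimes> (x \<otimes> y)" if "d \<in> D" for d using that x y' by (simp add: m_ac)
  then show ?thesis
    unfolding principal_prod[OF x fractional_ideal_principal[OF y]] unfolding principal_eq image_image
    by (rule image_cong[OF refl])
qed

lemma principal_one: "principal \<one> = D"
proof -
  have "(\<lambda>d. d \<otimes> \<one>) ` D = (\<lambda>d. d) ` D" by (rule image_cong) simp_all
  then show ?thesis unfolding principal_eq by simp
qed

lemma principal_inv:
  assumes x: "x \<in> fractions K D - {\<zero>}"
  shows "principal x \<cdot> principal (inv x) = D"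
proof -
  have c: "x \<in> Units K" using x by (simp add: fractions_iff field_Units)
  then have "principal x \<cdot> principal (inv x) = principal (x \<otimes> inv x)"
    by (intro principal_mult Units_closed) (use fractions_inv[OF x] in simp_all)
  then show ?thesis using principal_one Units_r_inv[OF c] by (simp only:)
qed

lemma invertibleI:
  "\<lbrakk>fractional_ideal K D J; fractional_ideal K D L; J \<cdot> L = D\<rbrakk> \<Longrightarrow> invertible_ideal K D J"
  unfolding invertible_ideal_def by blast

lemma invertible_carr: "invertible_ideal K D J \<Longrightarrow> J \<subseteq> carrier K"
  unfolding invertible_ideal_def by (elim conjE) (rule fractional_ideal_carr)

lemma invertible_prod:
  assumes "invertible_ideal K D J" "invertible_ideal K D L"
  shows "invertible_ideal K D (J \<cdot> L)"
proof -
  obtain J' L' where fr: "fractional_ideal K D J" "fractional_ideal K D J'"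
    "fractional_ideal K D L" "fractional_ideal K D L'" and e: "J \<cdot> J' = D" "L \<cdot> L' = D"
    using assms unfolding invertible_ideal_def by blast
  note c = fr[THEN fractional_ideal_carr]
  have "(J \<cdot> L) \<cdot> (L' \<cdot> J') = J \<cdot> ((L \<cdot> L') \<cdot> J')"
    using c by (simp add: ideal_prod_assoc ideal_prod_closed)
  also have "\<dots> = D" using e ideal_prod_D(2)[OF fr(2)] by simp
  finally show ?thesis
    by (rule invertibleI[OF fractional_ideal_prod[OF fr(1,3)] fractional_ideal_prod[OF fr(4,2)]])
qed

lemma invertible_D: "invertible_ideal K D D"
  using invertibleI[OF fractional_ideal_D fractional_ideal_D] ideal_prod_D(1)[OF fractional_ideal_D] .

lemma invertible_principal:
  assumes x: "x \<in> fractions K D - {\<zero>}"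
  shows "invertible_ideal K D (principal x)"
proof (rule invertibleI)
  show "principal x \<cdot> principal (inv x) = D"
    by (rule principal_inv[OF x])
  show "fractional_ideal K D (principal x)" "fractional_ideal K D (principal (inv x))"
    by (rule fractional_ideal_principal, use x fractions_inv[OF x] in simp)+
qed

abbreviation Inv :: "'a set monoid"
  where "Inv \<equiv> invertible_ideals K D"

lemma Inv_simps [simp]:
  "carrier Inv = {J. invertible_ideal K D J}" "J \<otimes>\<^bsub>Inv\<^esub> L = J \<cdot> L" "\<one>\<^bsub>Inv\<^esub> = D"
  by (simp_all add: invertible_ideals_def)

lemma Inv_comm_group: "comm_group Inv"
proof (rule comm_groupI; simp)
  show "invertible_ideal K D (J \<cdot> L)"
    if "invertible_ideal K D J" "invertible_ideal K D L" for J L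
    using that by (rule invertible_prod)
  show "invertible_ideal K D D" by (rule invertible_D)
  show "J \<cdot> L \<cdot> M = J \<cdot> (L \<cdot> M)"
    if "invertible_ideal K D J" "invertible_ideal K D L" "invertible_ideal K D M" for J L M
    using that by (simp add: ideal_prod_assoc invertible_carr)
  show "J \<cdot> L = L \<cdot> J" if "invertible_ideal K D J" "invertible_ideal K D L" for J L
    using that by (simp add: ideal_prod_comm invertible_carr)
  show "D \<cdot> J = J" if "invertible_ideal K D J" for J
    using that ideal_prod_D by (simp add: invertible_ideal_def)
  show "\<exists>L. invertible_ideal K D L \<and> L \<cdot> J = D" if J: "invertible_ideal K D J" for J
  proof -
    obtain L where "fractional_ideal K D J" "fractional_ideal K D L" "J \<cdot> L = D"
      using J unfolding invertible_ideal_def by auto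
    moreover from this have "L \<cdot> J = D"
      using ideal_prod_comm[OF fractional_ideal_carr fractional_ideal_carr] by auto
    ultimately show ?thesis using invertibleI by auto
  qed
qed

abbreviation Prin :: "'a set set"
  where "Prin \<equiv> principal_ideals K D"

lemma Prin_subgroup: "subgroup Prin Inv"
proof -
  interpret Inv: comm_group Inv by (rule Inv_comm_group)
  show ?thesis
  proof (rule Inv.subgroupI)
    show "Prin \<subseteq> carrier Inv" using invertible_principal by (auto simp: principal_ideals_def)
    show "Prin \<noteq> {}" using one_fractions by (auto simp: principal_ideals_def)
  next
    fix J assume "J \<in> Prin"
    then obtain x where x: "x \<in> fractions K D - {\<zero>}" and J: "J = principal x"
      by (auto simp: principal_ideals_def)
    have c: "invertible_ideal K D J" "invertible_ideal K D (principal (inv x))"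
      unfolding J by (rule invertible_principal[OF x] invertible_principal[OF fractions_inv[OF x]])+
    have "principal (inv x) \<otimes>\<^bsub>Inv\<^esub> J = \<one>\<^bsub>Inv\<^esub>"
      using Inv.m_comm[of "principal (inv x)" J] c principal_inv[OF x] by (simp add: J)
    then have "inv\<^bsub>Inv\<^esub> J = principal (inv x)"
      using c by (intro Inv.inv_equality) simp_all
    then show "inv\<^bsub>Inv\<^esub> J \<in> Prin"
      using fractions_inv[OF x] by (auto simp: principal_ideals_def)
  next
    fix J L assume "J \<in> Prin" "L \<in> Prin"
    then obtain x y where xy: "x \<in> fractions K D - {\<zero>}" "J = principal x"
      "y \<in> fractions K D - {\<zero>}" "L = principal y"
      by (auto simp: principal_ideals_def)
    then have c: "x \<in> carrier K" "y \<in> carrier K" by (auto simp: fractions_iff)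
    have "x \<otimes> y \<in> fractions K D - {\<zero>}"
      using xy c fractions_mult by (auto simp: integral_iff)
    then show "J \<otimes>\<^bsub>Inv\<^esub> L \<in> Prin"
      using xy c principal_mult[of x y] by (auto simp: principal_ideals_def)
  qed
qed

abbreviation cls :: "'a set \<Rightarrow> 'a set set"
  where "cls \<equiv> ideal_class K D"

lemma Cl_comm_group: "comm_group (Cl K D)"
  unfolding Cl_def using comm_group.abelian_FactGroup[OF Inv_comm_group Prin_subgroup] .

lemma cls_group_hom: "group_hom Inv (Cl K D) cls"
proof -
  interpret Inv: comm_group Inv by (rule Inv_comm_group)
  have "cls \<in> hom Inv (Cl K D)"
    using normal.r_coset_hom_Mod[OF Inv.subgroup_imp_normal[OF Prin_subgroup]]
    unfolding Cl_def ideal_class_def by simp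
  then show ?thesis
    using Inv.group_axioms comm_group.axioms(2)[OF Cl_comm_group]
    by (simp add: group_hom_def group_hom_axioms_def)
qed

lemma carrier_Cl: "carrier (Cl K D) = cls ` {J. invertible_ideal K D J}"
  unfolding Cl_def ideal_class_def FactGroup_def RCOSETS_def by auto

lemma cls_closed: "invertible_ideal K D J \<Longrightarrow> cls J \<in> carrier (Cl K D)"
  by (simp add: carrier_Cl)

lemma cls_prod:
  "\<lbrakk>invertible_ideal K D J; invertible_ideal K D L\<rbrakk> \<Longrightarrow> cls (J \<cdot> L) = cls J \<otimes>\<^bsub>Cl K D\<^esub> cls L"
  using group_hom.hom_mult[OF cls_group_hom, of J L] by simp

lemma cls_eq_one_iff:
  assumes "invertible_ideal K D J"
  shows "cls J = \<one>\<^bsub>Cl K D\<^esub> \<longleftrightarrow> J \<in> Prin"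
proof -
  interpret Inv: comm_group Inv by (rule Inv_comm_group)
  have "cls J = \<one>\<^bsub>Cl K D\<^esub> \<longleftrightarrow> Prin #>\<^bsub>Inv\<^esub> J = Prin"
    by (simp add: ideal_class_def Cl_def FactGroup_def)
  also have "\<dots> \<longleftrightarrow> J \<in> Prin"
    using assms Inv.coset_join1[OF _ _ Prin_subgroup, of J]
      Inv.coset_join2[OF _ Prin_subgroup, of J] subgroup.subset[OF Prin_subgroup] by auto
  finally show ?thesis .
qed

lemma principal_in_Prin: "x \<in> fractions K D - {\<zero>} \<Longrightarrow> principal x \<in> Prin"
  by (auto simp: principal_ideals_def)

lemma cls_principal: "x \<in> fractions K D - {\<zero>} \<Longrightarrow> cls (principal x) = \<one>\<^bsub>Cl K D\<^esub>"
  using cls_eq_one_iff[OF invertible_principal] principal_in_Prin by blast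

lemma mem_cls:
  assumes J: "invertible_ideal K D J" and L: "L \<in> cls J"
  shows "invertible_ideal K D L" "cls L = cls J"
    "\<exists>x\<in>fractions K D - {\<zero>}. L = principal x \<cdot> J"
proof -
  obtain x where x: "x \<in> fractions K D - {\<zero>}" and L': "L = principal x \<cdot> J"
    using L by (auto simp: ideal_class_def r_coset_def principal_ideals_def)
  show "invertible_ideal K D L" unfolding L' by (rule invertible_prod[OF invertible_principal[OF x] J])
  show "\<exists>x\<in>fractions K D - {\<zero>}. L = principal x \<cdot> J" using x L' by blast
  interpret Cl: comm_group "Cl K D" by (rule Cl_comm_group)
  show "cls L = cls J"
    using L' cls_prod[OF invertible_principal[OF x] J] cls_principal[OF x] cls_closed[OF J] by simp
qed

lemma cls_self: "invertible_ideal K D J \<Longrightarrow> J \<in> cls J"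
  using group.rcos_self[OF comm_group.axioms(2)[OF Inv_comm_group] _ Prin_subgroup, of J]
  by (simp add: ideal_class_def)

text \<open>A factor of a nonzero principal ideal is invertible. This produces inverses of contracted ideals
  without describing them.\<close>

lemma invertible_of_prod_principal:
  assumes J: "fractional_ideal K D J" and L: "fractional_ideal K D L"
    and x: "x \<in> fractions K D - {\<zero>}" and e: "J \<cdot> L = principal x"
  shows "invertible_ideal K D J"
proof (rule invertibleI[OF J fractional_ideal_prod[OF L]])
  have x': "inv x \<in> fractions K D - {\<zero>}" by (rule fractions_inv[OF x])
  then show f: "fractional_ideal K D (principal (inv x))" by (simp add: fractional_ideal_principal)
  have "J \<cdot> (L \<cdot> principal (inv x)) = principal x \<cdot> principal (inv x)"
    using e J L f by (simp add: ideal_prod_assoc[symmetric] fractional_ideal_carr)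
  also have "\<dots> = D" by (rule principal_inv[OF x])
  finally show "J \<cdot> (L \<cdot> principal (inv x)) = D" .
qed

end

section \<open>Units modulo an ideal\<close>

context cring
begin

lemma rcos_eq_iff:
  assumes "ideal I R" "a \<in> carrier R" "b \<in> carrier R"
  shows "I +> a = I +> b \<longleftrightarrow> a \<in> I +> b"
proof -
  interpret ideal I R by fact
  show ?thesis
    using a_rcos_self[OF assms(2)] a_repr_independence[OF _ assms(3) a_subgroup] by auto
qed

lemma mem_rcos: "y \<in> I +> b \<longleftrightarrow> (\<exists>i\<in>I. y = i \<oplus> b)"
  by (auto simp: a_r_coset_def')

lemma rcos_Units_iff:
  assumes I: "ideal I R" and a: "a \<in> carrier R"
  shows "I +> a \<in> Units (R Quot I) \<longleftrightarrow> (\<exists>b\<in>carrier R. \<exists>i\<in>I. a \<otimes> b \<oplus> i = \<one>)"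
proof -
  interpret ideal I R by fact
  interpret Q: cring "R Quot I" by (rule quotient_is_cring[OF is_cring])
  have cQ: "carrier (R Quot I) = (\<lambda>b. I +> b) ` carrier R"
    by (auto simp: FactRing_def A_RCOSETS_def')
  have m: "(I +> a) \<otimes>\<^bsub>R Quot I\<^esub> (I +> b) = I +> (a \<otimes> b)" if "b \<in> carrier R" for b
    using rcoset_mult_add[OF a that] by (simp add: FactRing_def)
  have 1: "\<one>\<^bsub>R Quot I\<^esub> = I +> \<one>" by (simp add: FactRing_def)
  have e: "I +> (a \<otimes> b) = I +> \<one> \<longleftrightarrow> (\<exists>i\<in>I. a \<otimes> b \<oplus> i = \<one>)" if b: "b \<in> carrier R" for b
  proof -
    have ab: "a \<otimes> b \<in> carrier R" using a b by simp
    have "I +> (a \<otimes> b) = I +> \<one> \<longleftrightarrow> \<one> \<in> I +> (a \<otimes> b)"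
      using rcos_eq_iff[OF I one_closed ab] by (simp only: eq_commute)
    also have "\<dots> \<longleftrightarrow> (\<exists>i\<in>I. a \<otimes> b \<oplus> i = \<one>)"
      unfolding mem_rcos by (rule bex_cong[OF refl]) (use ab a_comm Icarr in metis)
    finally show ?thesis .
  qed
  have "I +> a \<in> Units (R Quot I) \<longleftrightarrow>
    (\<exists>Y\<in>carrier (R Quot I). (I +> a) \<otimes>\<^bsub>R Quot I\<^esub> Y = \<one>\<^bsub>R Quot I\<^esub>)"
    using a Q.m_comm unfolding Units_def cQ by auto
  also have "\<dots> \<longleftrightarrow> (\<exists>b\<in>carrier R. \<exists>i\<in>I. a \<otimes> b \<oplus> i = \<one>)"
    unfolding cQ using m 1 e by auto
  finally show ?thesis .
qed

text \<open>The right-hand side is the one of \<open>rcos_Units_iff\<close>: an element generates an ideal comaximal to \<open>I\<close>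
  iff its coset is a unit. This links local association with the group \<open>U(T/I)\<close>.\<close>

lemma comaximal_cgenideal_iff:
  assumes I: "ideal I R" and a: "a \<in> carrier R"
  shows "set_add R (PIdl a) I = carrier R \<longleftrightarrow> (\<exists>b\<in>carrier R. \<exists>i\<in>I. a \<otimes> b \<oplus> i = \<one>)"
proof -
  have P: "ideal (set_add R (PIdl a) I) R"
    by (rule add_ideals[OF cgenideal_ideal[OF a] I])
  have "set_add R (PIdl a) I = carrier R \<longleftrightarrow> \<one> \<in> set_add R (PIdl a) I"
    using ideal.one_imp_carrier[OF P] one_closed by (metis (full_types))
  also have "\<dots> \<longleftrightarrow> (\<exists>b\<in>carrier R. \<exists>i\<in>I. \<one> = b \<otimes> a \<oplus> i)"
    unfolding set_add_def' cgenideal_def by blast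
  also have "\<dots> \<longleftrightarrow> (\<exists>b\<in>carrier R. \<exists>i\<in>I. a \<otimes> b \<oplus> i = \<one>)"
    by (intro bex_cong refl) (use a m_comm in metis)
  finally show ?thesis .
qed

end

context field_subring
begin

lemma cring_D: "cring (K\<lparr>carrier := D\<rparr>)"
proof -
  interpret D: ring "K\<lparr>carrier := D\<rparr>" by (rule subring_is_ring[OF subring])
  show ?thesis by unfold_locales (simp add: m_comm)
qed

lemma Units_iff: "v \<in> Units (K\<lparr>carrier := D\<rparr>) \<longleftrightarrow> v \<in> D \<and> (\<exists>w\<in>D. v \<otimes> w = \<one>)"
proof -
  have "w \<otimes> v = v \<otimes> w" if "v \<in> D" "w \<in> D" for v w using that by (simp add: m_comm)
  then show ?thesis unfolding Units_def by auto
qed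

lemma inv_eq:
  assumes "v \<in> D" "w \<in> D" "v \<otimes> w = \<one>"
  shows "inv\<^bsub>K\<lparr>carrier := D\<rparr>\<^esub> v = w"
proof -
  interpret D: cring "K\<lparr>carrier := D\<rparr>" by (rule cring_D)
  show ?thesis using D.comm_inv_char[of v w] assms by simp
qed

end

section \<open>A subring and its conductor\<close>

text \<open>The overring is represented by its carrier \<open>B\<close>, so that all operations are those of \<open>K\<close>.\<close>

locale domain_extension = field K for K :: "'a ring" (structure) +
  fixes R B :: "'a set"
  assumes subring_R: "subring R K" and subring_B: "subring B K"
    and R_sub_B: "R \<subseteq> B" and fractions_B: "carrier K = fractions K B"
begin

sublocale S: field_subring K R
  by (intro field_subring.intro field_subring_axioms.intro field_axioms subring_R)

sublocale T: field_subring K B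
  by (intro field_subring.intro field_subring_axioms.intro field_axioms subring_B)

abbreviation SR :: "'a ring" where "SR \<equiv> K\<lparr>carrier := R\<rparr>"
abbreviation TB :: "'a ring" where "TB \<equiv> K\<lparr>carrier := B\<rparr>"

abbreviation I :: "'a set" where "I \<equiv> conductor TB R"

lemma R_B: "r \<in> R \<Longrightarrow> r \<in> B"
  using R_sub_B by auto

lemma T_fractions: "x \<in> carrier K \<Longrightarrow> x \<in> fractions K B"
  by (subst fractions_B[symmetric])

lemma B_fractions: "t \<in> B \<Longrightarrow> t \<in> fractions K B"
  by (rule T_fractions[OF T.D_carr])

lemma I_iff: "i \<in> I \<longleftrightarrow> i \<in> R \<and> (\<forall>t\<in>B. i \<otimes> t \<in> R)"
  by (simp add: conductor_def)

lemma I_R: "i \<in> I \<Longrightarrow> i \<in> R"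
  by (simp add: I_iff)

lemma I_carr: "i \<in> I \<Longrightarrow> i \<in> carrier K"
  using I_R by simp

lemma I_mult: "\<lbrakk>i \<in> I; t \<in> B\<rbrakk> \<Longrightarrow> i \<otimes> t \<in> I"
  using T.D(6) by (simp add: I_iff m_assoc)

lemma I_mult_R: "\<lbrakk>i \<in> I; t \<in> B\<rbrakk> \<Longrightarrow> i \<otimes> t \<in> R"
  by (simp add: I_iff)

lemma I_subgroup: "subgroup I (add_monoid K)"
proof (rule add.subgroupI)
  show "I \<subseteq> carrier K" using I_carr by blast
  have "\<zero> \<in> I" using S.D(2) by (simp add: I_iff)
  then show "I \<noteq> {}" by blast
  show "\<ominus> i \<in> I" if "i \<in> I" for i
    using that S.D(5) by (simp add: I_iff l_minus)
  show "i \<oplus> j \<in> I" if "i \<in> I" "j \<in> I" for i j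
    using that S.D(7) by (simp add: I_iff l_distr)
qed

lemma I_add: "\<lbrakk>i \<in> I; j \<in> I\<rbrakk> \<Longrightarrow> i \<oplus> j \<in> I"
  using subgroup.m_closed[OF I_subgroup] by simp

lemma I_neg: "i \<in> I \<Longrightarrow> \<ominus> i \<in> I"
  using subgroup.m_inv_closed[OF I_subgroup] by (simp add: a_inv_def)

text \<open>Used with \<open>D = R\<close> and \<open>D = B\<close>.\<close>

lemma I_ideal_of:
  assumes D: "field_subring K D" and "R \<subseteq> D" "D \<subseteq> B"
  shows "ideal I (K\<lparr>carrier := D\<rparr>)"
proof -
  interpret D: field_subring K D by fact
  interpret DR: cring "K\<lparr>carrier := D\<rparr>" by (rule D.cring_D)
  have sub: "I \<subseteq> D" using I_R assms by blast
  have neg: "\<ominus>\<^bsub>K\<lparr>carrier := D\<rparr>\<^esub> i \<in> I" if "i \<in> I" for i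
  proof -
    have "\<ominus> i \<oplus> i = \<zero>" using I_carr[OF that] by (rule l_neg)
    then have "\<ominus>\<^bsub>K\<lparr>carrier := D\<rparr>\<^esub> i = \<ominus> i"
      using DR.minus_equality[of "\<ominus> i" i] that I_neg[OF that] sub by auto
    then show ?thesis using I_neg[OF that] by simp
  qed
  show ?thesis
  proof (rule idealI[OF DR.ring_axioms])
    show "subgroup I (add_monoid (K\<lparr>carrier := D\<rparr>))"
    proof (rule DR.add.subgroupI)
      show "I \<noteq> {}" using subgroup.one_closed[OF I_subgroup] by blast
    qed (use sub neg I_add in auto)
    fix i x assume "i \<in> I" "x \<in> carrier (K\<lparr>carrier := D\<rparr>)"
    then have ix: "i \<in> I" "x \<in> B" "x \<in> carrier K" using assms by auto
    then show "i \<otimes>\<^bsub>K\<lparr>carrier := D\<rparr>\<^esub> x \<in> I" "x \<otimes>\<^bsub>K\<lparr>carrier := D\<rparr>\<^esub> i \<in> I"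
      using I_mult[OF ix(1,2)] m_comm[OF I_carr[OF ix(1)] ix(3)] by simp_all
  qed
qed

lemma I_ideal_T: "ideal I TB"
  using I_ideal_of[OF T.field_subring_axioms] R_sub_B by blast

lemma I_ideal_S: "ideal I SR"
  using I_ideal_of[OF S.field_subring_axioms] R_sub_B by blast

text \<open>Explicit witnesses for the condition that \<open>t\<close> be invertible modulo \<open>I\<close> in \<open>D\<close>, where \<open>D\<close> is
  \<open>R\<close> or \<open>B\<close>.\<close>

definition unit_mod :: "'a set \<Rightarrow> 'a \<Rightarrow> bool"
  where "unit_mod D t \<longleftrightarrow> t \<in> D \<and> (\<exists>s\<in>D. \<exists>i\<in>I. t \<otimes> s \<oplus> i = \<one>)"

lemma unit_modE:
  assumes "unit_mod D t"
  obtains s i where "t \<in> D" "s \<in> D" "i \<in> I" "t \<otimes> s \<oplus> i = \<one>"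
  using assms unfolding unit_mod_def by blast

lemma unit_modI: "\<lbrakk>t \<in> D; s \<in> D; i \<in> I; t \<otimes> s \<oplus> i = \<one>\<rbrakk> \<Longrightarrow> unit_mod D t"
  unfolding unit_mod_def by blast

lemma unit_mod_R_B: "unit_mod R t \<Longrightarrow> unit_mod B t"
  unfolding unit_mod_def using R_B by blast

lemma coset_eq [simp]: "A +>\<^bsub>K\<lparr>carrier := D\<rparr>\<^esub> t = A +> t"
  by (simp add: a_r_coset_def r_coset_def)

lemma Units_T_iff: "t \<in> B \<Longrightarrow> I +> t \<in> Units (TB Quot I) \<longleftrightarrow> unit_mod B t"
  using cring.rcos_Units_iff[OF T.cring_D I_ideal_T, of t] by (simp add: unit_mod_def)

lemma Units_S_iff: "t \<in> R \<Longrightarrow> I +> t \<in> Units (SR Quot I) \<longleftrightarrow> unit_mod R t"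
  using cring.rcos_Units_iff[OF S.cring_D I_ideal_S, of t] by (simp add: unit_mod_def)

lemma comaximal_T_iff: "t \<in> B \<Longrightarrow> comaximal TB (T.principal t) I \<longleftrightarrow> unit_mod B t"
  using cring.comaximal_cgenideal_iff[OF T.cring_D I_ideal_T, of t] by (simp add: unit_mod_def comaximal_def)

lemma comaximal_S_iff: "t \<in> R \<Longrightarrow> comaximal SR (S.principal t) I \<longleftrightarrow> unit_mod R t"
  using cring.comaximal_cgenideal_iff[OF S.cring_D I_ideal_S, of t] by (simp add: unit_mod_def comaximal_def)

lemma coset_eq_iff:
  assumes "a \<in> B" "b \<in> B"
  shows "I +> a = I +> b \<longleftrightarrow> (\<exists>i\<in>I. a = i \<oplus> b)"
  using cring.rcos_eq_iff[OF T.cring_D I_ideal_T, of a b] assms by (simp add: mem_rcos)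

lemma unit_mod_mult:
  assumes D: "R \<subseteq> D" "D \<subseteq> B" "field_subring K D" and t: "unit_mod D t" and t': "unit_mod D t'"
  shows "unit_mod D (t \<otimes> t')"
proof -
  interpret D: field_subring K D by fact
  obtain s i where s: "t \<in> D" "s \<in> D" "i \<in> I" "t \<otimes> s \<oplus> i = \<one>" using t by (rule unit_modE)
  obtain s' i' where s': "t' \<in> D" "s' \<in> D" "i' \<in> I" "t' \<otimes> s' \<oplus> i' = \<one>"
    using t' by (rule unit_modE)
  note c = s(1-2)[THEN D.D_carr] s'(1-2)[THEN D.D_carr] I_carr[OF s(3)] I_carr[OF s'(3)]
  have j: "i' \<otimes> (t \<otimes> s) \<oplus> i \<in> I"
    using s s' D I_mult I_add D.D(6) by (metis subsetD)
  have "t \<otimes> t' \<otimes> (s \<otimes> s') \<oplus> (i' \<otimes> (t \<otimes> s) \<oplus> i) = (t \<otimes> s) \<otimes> (t' \<otimes> s' \<oplus> i') \<oplus> i"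
    using c by algebra
  also have "\<dots> = \<one>" using s s' c by simp
  finally show ?thesis
    using unit_modI[OF D.D(6)[OF s(1) s'(1)] D.D(6)[OF s(2) s'(2)] j] by simp
qed

text \<open>An element congruent to \<open>1\<close> modulo the conductor lies in \<open>R\<close> because the conductor does. In this
  way an element \<open>ts\<close> of the overring is recognised as one of \<open>R\<close>.\<close>

lemma one_minus_R:
  assumes "z \<oplus> j = \<one>" "j \<in> I" "z \<in> carrier K"
  shows "z \<in> R"
proof -
  have "z = (z \<oplus> j) \<oplus> \<ominus> j" using assms(3) I_carr[OF assms(2)] by algebra
  then have "z = \<one> \<oplus> \<ominus> j" unfolding assms(1) .
  then show ?thesis using S.D(3,7) I_R I_neg assms(2) by metis
qed

lemma one_minus_unit_mod:
  assumes "z \<oplus> j = \<one>" "j \<in> I" "z \<in> carrier K"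
  shows "unit_mod R z"
  using one_minus_R[OF assms] assms S.D(3) by (intro unit_modI[of z R \<one> j]) simp_all

section \<open>Contracting principal ideals of the overring\<close>

definition contraction :: "'a \<Rightarrow> 'a set"
  where "contraction t = T.principal t \<inter> R"

lemma contraction_iff: "x \<in> contraction t \<longleftrightarrow> x \<in> R \<and> (\<exists>b\<in>B. x = b \<otimes> t)"
  by (auto simp: contraction_def T.principal_eq)

lemma contractionI: 
  assumes "b \<otimes> t \<in> R" "b \<in> B"
  shows "b \<otimes> t \<in> contraction t"
  unfolding contraction_iff by (intro conjI bexI[of _ b] refl assms)

lemma contraction_fractional:
  assumes t: "t \<in> B"
  shows "fractional_ideal K R (contraction t)"
  unfolding S.fractional_ideal_iff
proof (intro conjI ballI bexI)
  have "fractional_ideal K B (T.principal t)"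
    by (rule T.fractional_ideal_principal[OF B_fractions[OF t]])
  then have sg: "subgroup (T.principal t) (add_monoid K)" and m: "\<And>b x. \<lbrakk>b \<in> B; x \<in> T.principal t\<rbrakk> \<Longrightarrow> b \<otimes> x \<in> T.principal t"
    by (auto simp: T.fractional_ideal_iff)
  show "subgroup (contraction t) (add_monoid K)"
    unfolding contraction_def using add.subgroups_Inter_pair[OF sg subring.axioms(1)[OF subring_R]] .
  show "d \<otimes> x \<in> contraction t" if "d \<in> R" "x \<in> contraction t" for d x
    using that m R_B S.D(6) by (simp add: contraction_def)
  show "\<one> \<otimes> x \<in> R" if "x \<in> contraction t" for x using that by (simp add: contraction_def)
  show "\<one> \<in> R - {\<zero>}" using S.D(3) by simp
qed

text \<open>If \<open>x = yr \<in> R\<close> and \<open>rr' + i = 1\<close>, then \<open>y = xr' + iy\<close> lies in \<open>R\<close>.\<close>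

lemma contraction_of_R:
  assumes r: "unit_mod R r"
  shows "contraction r = S.principal r"
proof
  obtain r' i where r': "r \<in> R" "r' \<in> R" "i \<in> I" "r \<otimes> r' \<oplus> i = \<one>" using r by (rule unit_modE)
  show "S.principal r \<subseteq> contraction r" using r' by (auto simp: S.principal_eq intro!: contractionI R_B S.D(6))
  show "contraction r \<subseteq> S.principal r"
  proof
    fix x assume "x \<in> contraction r"
    then obtain y where y: "y \<in> B" "x = y \<otimes> r" and x: "x \<in> R" unfolding contraction_iff by blast
    have c: "y \<in> carrier K" "r \<in> carrier K" "r' \<in> carrier K" "i \<in> carrier K"
      using y r' I_carr by simp_all
    have "y = y \<otimes> (r \<otimes> r' \<oplus> i)" using r' c by simp
    also have "\<dots> = x \<otimes> r' \<oplus> i \<otimes> y" using c y(2) by algebra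
    finally have "y \<in> R" using x r' y I_mult_R S.D(6,7) by metis
    then show "x \<in> S.principal r" using y by (auto simp: S.principal_eq)
  qed
qed

lemma contraction_unit:
  assumes u: "u \<in> Units TB" and t: "t \<in> B"
  shows "contraction (u \<otimes> t) = contraction t"
proof -
  obtain w where w: "u \<in> B" "w \<in> B" "u \<otimes> w = \<one>" using u by (auto simp: T.Units_iff)
  have c: "u \<in> carrier K" "w \<in> carrier K" "t \<in> carrier K" using w t by simp_all
  have "T.principal (u \<otimes> t) = T.principal t"
  proof
    have "b \<otimes> (u \<otimes> t) = (b \<otimes> u) \<otimes> t" if "b \<in> B" for b using that c by (simp add: m_assoc)
    then show "T.principal (u \<otimes> t) \<subseteq> T.principal t" using w T.D(6) by (auto simp: T.principal_eq)
    show "T.principal t \<subseteq> T.principal (u \<otimes> t)"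
    proof
      fix x assume "x \<in> T.principal t"
      then obtain b where b: "b \<in> B" "x = b \<otimes> t" by (auto simp: T.principal_eq)
      have "(b \<otimes> w) \<otimes> (u \<otimes> t) = (b \<otimes> t) \<otimes> (u \<otimes> w)" using b c by (simp add: m_ac)
      then have "x = (b \<otimes> w) \<otimes> (u \<otimes> t)" using b w c by simp
      then show "x \<in> T.principal (u \<otimes> t)"
        unfolding T.principal_eq by (rule image_eqI) (rule T.D(6)[OF b(1) w(2)])
    qed
  qed
  then show ?thesis by (simp add: contraction_def)
qed

text \<open>For \<open>x = ytt' \<in> R\<close> expand \<open>x(ts + i)(t's' + i')\<close>. Each of the four summands splits into a
  factor divisible by \<open>t\<close> and one divisible by \<open>t'\<close>, and each factor lies in \<open>R\<close> because it contains
  \<open>ts\<close>, \<open>t's'\<close>, \<open>i\<close> or \<open>i'\<close>.\<close>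

lemma contraction_mult:
  assumes t: "unit_mod B t" and t': "unit_mod B t'"
  shows "contraction t \<cdot> contraction t' = contraction (t \<otimes> t')"
proof
  obtain s i where s: "t \<in> B" "s \<in> B" "i \<in> I" "t \<otimes> s \<oplus> i = \<one>" using t by (rule unit_modE)
  obtain s' i' where s': "t' \<in> B" "s' \<in> B" "i' \<in> I" "t' \<otimes> s' \<oplus> i' = \<one>"
    using t' by (rule unit_modE)
  have tt: "t \<otimes> t' \<in> B" using s s' T.D(6) by blast
  show "contraction t \<cdot> contraction t' \<subseteq> contraction (t \<otimes> t')"
  proof (rule ideal_prod_least)
    fix a b assume "a \<in> contraction t" "b \<in> contraction t'"
    then obtain x y where xy: "x \<in> B" "y \<in> B" "a = x \<otimes> t" "b = y \<otimes> t'" "a \<in> R" "b \<in> R"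
      unfolding contraction_iff by blast
    have "a \<otimes> b = (x \<otimes> y) \<otimes> (t \<otimes> t')" using xy s s' by (simp add: m_ac)
    then show "a \<otimes> b \<in> contraction (t \<otimes> t')" using xy T.D(6) S.D(6) unfolding contraction_iff by blast
  qed (rule S.fractional_ideal_add[OF contraction_fractional[OF tt]])
  show "contraction (t \<otimes> t') \<subseteq> contraction t \<cdot> contraction t'"
  proof
    fix x assume "x \<in> contraction (t \<otimes> t')"
    then obtain y where y: "y \<in> B" "x = y \<otimes> (t \<otimes> t')" and x: "x \<in> R" unfolding contraction_iff by blast
    have c: "y \<in> carrier K" "t \<in> carrier K" "s \<in> carrier K" "i \<in> carrier K" "x \<in> carrier K"
      "t' \<in> carrier K" "s' \<in> carrier K" "i' \<in> carrier K"
      using y s s' x I_carr by simp_all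
    have e: "t \<otimes> s \<in> R" "t' \<otimes> s' \<in> R" using one_minus_R s s' c by auto
    have 1: "(x \<otimes> s) \<otimes> t \<in> contraction t" "s' \<otimes> t' \<in> contraction t'"
    proof -
      have "(x \<otimes> s) \<otimes> t = x \<otimes> (t \<otimes> s)" using c by (simp add: m_ac)
      then show "(x \<otimes> s) \<otimes> t \<in> contraction t"
        using e x s R_B T.D(6) S.D(6) by (intro contractionI) auto
      show "s' \<otimes> t' \<in> contraction t'" using e s' c by (intro contractionI) (simp_all add: m_comm)
    qed
    have 2: "s \<otimes> t \<in> contraction t" "(i' \<otimes> (y \<otimes> t)) \<otimes> t' \<in> contraction t'"
    proof -
      show "s \<otimes> t \<in> contraction t" using e s c by (intro contractionI) (simp_all add: m_comm)
      have "(i' \<otimes> (y \<otimes> t)) \<otimes> t' = i' \<otimes> x" using y c by (simp add: m_ac)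
      then show "(i' \<otimes> (y \<otimes> t)) \<otimes> t' \<in> contraction t'"
        using I_mult_R[OF s'(3) R_B[OF x]] I_mult_R[OF s'(3)] s y T.D(6) R_B
        by (intro contractionI) auto
    qed
    have 3: "(i \<otimes> (y \<otimes> t')) \<otimes> t \<in> contraction t"
    proof -
      have "(i \<otimes> (y \<otimes> t')) \<otimes> t = i \<otimes> x" using y c by (simp add: m_ac)
      then show "(i \<otimes> (y \<otimes> t')) \<otimes> t \<in> contraction t"
        using I_mult_R[OF s(3) R_B[OF x]] I_mult_R[OF s(3)] s' y T.D(6) R_B
        by (intro contractionI) auto
    qed
    have 4: "i \<otimes> t \<in> contraction t" "(i' \<otimes> y) \<otimes> t' \<in> contraction t'"
    proof -
      show "i \<otimes> t \<in> contraction t" using s I_mult_R I_R R_B by (intro contractionI) auto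
      have "(i' \<otimes> y) \<otimes> t' = i' \<otimes> (y \<otimes> t')" using c by (simp add: m_assoc)
      then show "(i' \<otimes> y) \<otimes> t' \<in> contraction t'"
        using s' y T.D(6) I_mult_R R_B by (intro contractionI) auto
    qed
    have "x = x \<otimes> ((t \<otimes> s \<oplus> i) \<otimes> (t' \<otimes> s' \<oplus> i'))" using s s' c by simp
    also have "\<dots> = ((x \<otimes> s) \<otimes> t) \<otimes> (s' \<otimes> t') \<oplus> (s \<otimes> t) \<otimes> ((i' \<otimes> (y \<otimes> t)) \<otimes> t')
        \<oplus> ((i \<otimes> (y \<otimes> t')) \<otimes> t) \<otimes> (s' \<otimes> t') \<oplus> (i \<otimes> t) \<otimes> ((i' \<otimes> y) \<otimes> t')"
      unfolding y(2) using c(1-4,6-8) by algebra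
    also have "\<dots> \<in> contraction t \<cdot> contraction t'"
      by (intro ideal_prod.sum ideal_prod.prod 1 2 3 4)
    finally show "x \<in> contraction t \<cdot> contraction t'" .
  qed
qed


text \<open>A single \<open>s\<close> that makes \<open>t's\<close> congruent to \<open>1\<close> for every \<open>t'\<close> in the coset of \<open>t\<close>, so
  that \<open>t's\<close> is a unit modulo \<open>I\<close> in \<open>R\<close>. It must be nonzero in order to generate an invertible ideal.\<close>

lemma complement:
  assumes t: "unit_mod B t" and t0: "t \<noteq> \<zero>"
  obtains s where "unit_mod B s" "s \<noteq> \<zero>" "unit_mod R (t \<otimes> s)"
    "\<And>j. j \<in> I \<Longrightarrow> unit_mod R ((j \<oplus> t) \<otimes> s)"
proof -
  obtain s0 i0 where s0: "t \<in> B" "s0 \<in> B" "i0 \<in> I" "t \<otimes> s0 \<oplus> i0 = \<one>" using t by (rule unit_modE)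
  have "\<exists>s\<in>B. \<exists>i\<in>I. t \<otimes> s \<oplus> i = \<one> \<and> s \<noteq> \<zero>"
  proof (cases "s0 = \<zero>")
    case True
    \<comment> \<open>Then \<open>I\<close> is all of \<open>T\<close>, and \<open>s = 1\<close>, \<open>i = 1 - t\<close> will do.\<close>
    then have one: "\<one> \<in> I" using s0 I_carr by simp
    have "\<one> \<oplus> \<ominus> t \<in> I"
      using I_mult[OF one, of "\<one> \<oplus> \<ominus> t"] s0(1) T.D(3,5,7) by simp
    moreover have "t \<otimes> \<one> \<oplus> (\<one> \<oplus> \<ominus> t) = \<one>" using T.D_carr[OF s0(1)] by algebra
    ultimately show ?thesis using T.D(3) one_not_zero by blast
  next
    case False
    then show ?thesis using s0 by blast
  qed
  then obtain s i where s: "s \<in> B" "i \<in> I" "t \<otimes> s \<oplus> i = \<one>" "s \<noteq> \<zero>" by blast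
  have c: "t \<in> carrier K" "s \<in> carrier K" "i \<in> carrier K" using s s0 I_carr by simp_all
  have 1: "unit_mod B s"
    by (rule unit_modI[OF s(1) s0(1) s(2)]) (use s c in \<open>simp add: m_comm\<close>)
  have 2: "unit_mod R (t \<otimes> s)" by (rule one_minus_unit_mod[OF s(3,2)]) (use c in simp)
  have 3: "unit_mod R ((j \<oplus> t) \<otimes> s)" if j: "j \<in> I" for j
  proof (rule one_minus_unit_mod)
    note jc = I_carr[OF j]
    show "i \<oplus> \<ominus> (j \<otimes> s) \<in> I" using I_add[OF s(2) I_neg[OF I_mult[OF j s(1)]]] .
    have "(j \<oplus> t) \<otimes> s \<oplus> (i \<oplus> \<ominus> (j \<otimes> s)) = t \<otimes> s \<oplus> i" using c jc by algebra
    then show "(j \<oplus> t) \<otimes> s \<oplus> (i \<oplus> \<ominus> (j \<otimes> s)) = \<one>" using s by simp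
    show "(j \<oplus> t) \<otimes> s \<in> carrier K" using c jc by simp
  qed
  show thesis using that 1 2 3 s(4) by blast
qed

lemma unit_mod_carr: "unit_mod B t \<Longrightarrow> t \<in> carrier K"
  by (erule unit_modE) simp

lemma R_fractions: "r \<in> R \<Longrightarrow> r \<in> fractions K R"
  by (rule S.fractionsI[of _ \<one>]) (use S.D(3) in simp_all)

lemma cls_principal_R: "\<lbrakk>unit_mod R e; e \<noteq> \<zero>\<rbrakk> \<Longrightarrow> S.cls (S.principal e) = \<one>\<^bsub>Cl K R\<^esub>"
  by (rule S.cls_principal) (auto simp: unit_mod_def R_fractions)

lemma contraction_invertible:
  assumes t: "unit_mod B t" and t0: "t \<noteq> \<zero>"
  shows "invertible_ideal K R (contraction t)"
proof -
  obtain s where s: "unit_mod B s" "s \<noteq> \<zero>" "unit_mod R (t \<otimes> s)"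
    using complement[OF t t0] by blast
  have "t \<otimes> s \<in> fractions K R - {\<zero>}"
    using s t0 integral_iff unit_mod_carr[OF t] unit_mod_carr[OF s(1)] R_fractions
    by (auto elim: unit_modE)
  moreover have "contraction t \<cdot> contraction s = S.principal (t \<otimes> s)"
    using contraction_mult[OF t s(1)] contraction_of_R[OF s(3)] by simp
  ultimately show ?thesis
    using t s(1) by (intro S.invertible_of_prod_principal[OF contraction_fractional contraction_fractional])
      (auto elim: unit_modE)
qed

text \<open>Both classes are inverse to the class of \<open>sB \<inter> R\<close> for a common complement \<open>s\<close>.\<close>

lemma contraction_cls_cong:
  assumes t: "unit_mod B t" "t \<noteq> \<zero>" and t': "unit_mod B t'" "t' \<noteq> \<zero>"
    and j: "j \<in> I" "t' = j \<oplus> t"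
  shows "S.cls (contraction t') = S.cls (contraction t)"
proof -
  interpret Cl: comm_group "Cl K R" by (rule S.Cl_comm_group)
  obtain s where s: "unit_mod B s" "s \<noteq> \<zero>" "unit_mod R (t \<otimes> s)" "unit_mod R (t' \<otimes> s)"
    using complement[OF t] j by metis
  have e: "S.cls (contraction x) \<otimes>\<^bsub>Cl K R\<^esub> S.cls (contraction s) = \<one>\<^bsub>Cl K R\<^esub>"
    if x: "unit_mod B x" "x \<noteq> \<zero>" "unit_mod R (x \<otimes> s)" for x
  proof -
    have "x \<otimes> s \<noteq> \<zero>"
      using x s integral_iff[OF unit_mod_carr unit_mod_carr] by blast
    then have "S.cls (S.principal (x \<otimes> s)) = \<one>\<^bsub>Cl K R\<^esub>" by (rule cls_principal_R[OF x(3)])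
    then show ?thesis
      using S.cls_prod[OF contraction_invertible[OF x(1,2)] contraction_invertible[OF s(1,2)]]
        contraction_mult[OF x(1) s(1)] contraction_of_R[OF x(3)] by simp
  qed
  have "S.cls (contraction t') \<otimes>\<^bsub>Cl K R\<^esub> S.cls (contraction s) = S.cls (contraction t) \<otimes>\<^bsub>Cl K R\<^esub> S.cls (contraction s)"
    using e[OF t s(3)] e[OF t' s(4)] by simp
  then show ?thesis
    using S.cls_closed[OF contraction_invertible] s(1,2) t t' by simp
qed

section \<open>Extension of ideals\<close>

lemma B_carr: "B \<subseteq> carrier K" by (rule T.D(1))

lemma ext_B: "B \<cdot> B = B" by (rule T.ideal_prod_D[OF T.fractional_ideal_D])

lemma ext_R: "R \<cdot> B = B"
proof
  show "R \<cdot> B \<subseteq> B" using ideal_prod_mono[OF R_sub_B order_refl, of K B] ext_B by blast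
  show "B \<subseteq> R \<cdot> B"
  proof
    fix b assume b: "b \<in> B"
    then show "b \<in> R \<cdot> B" using ideal_prod.prod[OF S.D(3) b, of K] by simp
  qed
qed

lemma ext_fractional:
  assumes J: "fractional_ideal K R J"
  shows "fractional_ideal K B (J \<cdot> B)"
proof -
  have Jc: "J \<subseteq> carrier K" by (rule S.fractional_ideal_carr[OF J])
  have c: "J \<cdot> B \<subseteq> carrier K" by (rule ideal_prod_closed[OF Jc B_carr])
  obtain d where d: "d \<in> R - {\<zero>}" "\<And>x. x \<in> J \<Longrightarrow> d \<otimes> x \<in> R"
    using J unfolding S.fractional_ideal_iff by blast
  have JB: "B \<cdot> (J \<cdot> B) = J \<cdot> B"
    using ideal_prod_comm[OF B_carr c] ideal_prod_assoc[OF Jc B_carr B_carr] ext_B by simp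
  have den: "d \<otimes> x \<in> B" if "x \<in> J \<cdot> B" for x
    using that
  proof (induct rule: ideal_prod.induct)
    case (prod j b)
    then have "j \<in> carrier K" using Jc by blast
    then have "d \<otimes> (j \<otimes> b) = (d \<otimes> j) \<otimes> b" using prod d by (simp add: m_assoc)
    then show ?case using T.D(6)[OF R_B[OF d(2)[OF prod(1)]] prod(2)] by simp
  next
    case (sum x y)
    then have "x \<in> carrier K" "y \<in> carrier K" using c by blast+
    then have "d \<otimes> (x \<oplus> y) = d \<otimes> x \<oplus> d \<otimes> y" using d by (simp add: r_distr)
    then show ?case using sum T.D(7) by simp
  qed
  show ?thesis
    unfolding T.fractional_ideal_iff
  proof (intro conjI ballI bexI)
    show "subgroup (J \<cdot> B) (add_monoid K)"
      by (rule ideal_prod_subgroup)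
        (use J subring.axioms(1)[OF subring_B] in \<open>simp_all add: S.fractional_ideal_iff\<close>)
    show "b \<otimes> x \<in> J \<cdot> B" if "b \<in> B" "x \<in> J \<cdot> B" for b x
      using ideal_prod.prod[OF that, of K] JB by simp
    show "d \<otimes> x \<in> B" if "x \<in> J \<cdot> B" for x using den that .
    show "d \<in> B - {\<zero>}" using d R_B by simp
  qed
qed

lemma ext_prod:
  assumes "J \<subseteq> carrier K" "L \<subseteq> carrier K"
  shows "(J \<cdot> L) \<cdot> B = (J \<cdot> B) \<cdot> (L \<cdot> B)"
proof -
  have "(J \<cdot> B) \<cdot> (L \<cdot> B) = J \<cdot> ((B \<cdot> L) \<cdot> B)"
    using assms B_carr by (simp add: ideal_prod_assoc ideal_prod_closed)
  also have "(B \<cdot> L) \<cdot> B = L \<cdot> (B \<cdot> B)"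
    using assms B_carr by (simp add: ideal_prod_comm[of B L] ideal_prod_assoc)
  also have "J \<cdot> (L \<cdot> (B \<cdot> B)) = (J \<cdot> L) \<cdot> B"
    using assms B_carr ext_B by (simp add: ideal_prod_assoc)
  finally show ?thesis by simp
qed

lemma ext_invertible:
  assumes "invertible_ideal K R J"
  shows "invertible_ideal K B (J \<cdot> B)"
proof -
  obtain L where L: "fractional_ideal K R J" "fractional_ideal K R L" "J \<cdot> L = R"
    using assms unfolding invertible_ideal_def by blast
  have "(J \<cdot> B) \<cdot> (L \<cdot> B) = B"
    using ext_prod[OF S.fractional_ideal_carr[OF L(1)] S.fractional_ideal_carr[OF L(2)]] L(3) ext_R
    by simp
  then show ?thesis
    by (rule T.invertibleI[OF ext_fractional[OF L(1)] ext_fractional[OF L(2)]])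
qed

lemma ext_principal:
  assumes x: "x \<in> carrier K"
  shows "S.principal x \<cdot> B = T.principal x"
proof
  have "S.principal x \<cdot> B \<subseteq> T.principal x \<cdot> B"
    by (rule ideal_prod_mono) (use R_B in \<open>auto simp: S.principal_eq T.principal_eq\<close>)
  also have "\<dots> = T.principal x"
    by (rule T.ideal_prod_D[OF T.fractional_ideal_principal[OF T_fractions[OF x]]])
  finally show "S.principal x \<cdot> B \<subseteq> T.principal x" .
  show "T.principal x \<subseteq> S.principal x \<cdot> B"
  proof
    fix y assume "y \<in> T.principal x"
    then obtain b where b: "b \<in> B" "y = b \<otimes> x" by (auto simp: T.principal_eq)
    then have "y = x \<otimes> b" using x by (simp add: m_comm)
    then show "y \<in> S.principal x \<cdot> B" using ideal_prod.prod[OF S.principal_self[OF x] b(1), of K] by simp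
  qed
qed

lemma nonzero_fractions: "x \<in> fractions K R - {\<zero>} \<Longrightarrow> x \<in> fractions K B - {\<zero>}"
  using T_fractions S.fractions_iff by blast

text \<open>From \<open>1 = ts + i\<close> one gets \<open>t = t \<cdot> ts + it\<close>, where \<open>ts\<close> and \<open>it\<close> are in the contraction.\<close>

lemma ext_contraction:
  assumes t: "unit_mod B t"
  shows "contraction t \<cdot> B = T.principal t"
proof
  obtain s i where s: "t \<in> B" "s \<in> B" "i \<in> I" "t \<otimes> s \<oplus> i = \<one>" using t by (rule unit_modE)
  have c: "t \<in> carrier K" "s \<in> carrier K" "i \<in> carrier K" using s I_carr by simp_all
  have "contraction t \<cdot> B \<subseteq> T.principal t \<cdot> B"
    by (rule ideal_prod_mono) (auto simp: contraction_def)
  also have "\<dots> = T.principal t"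
    by (rule T.ideal_prod_D[OF T.fractional_ideal_principal[OF B_fractions[OF s(1)]]])
  finally show "contraction t \<cdot> B \<subseteq> T.principal t" .
  show "T.principal t \<subseteq> contraction t \<cdot> B"
  proof
    fix y assume "y \<in> T.principal t"
    then obtain b where b: "b \<in> B" "y = b \<otimes> t" by (auto simp: T.principal_eq)
    have "t \<otimes> s \<in> R" using one_minus_R[OF s(4,3)] c by simp
    then have 1: "s \<otimes> t \<in> contraction t" using s c by (intro contractionI) (simp_all add: m_comm)
    have 2: "i \<otimes> t \<in> contraction t" using s I_mult_R R_B I_R by (intro contractionI) simp_all
    have "y = (b \<otimes> t) \<otimes> (t \<otimes> s \<oplus> i)" using b s c by simp
    also have "\<dots> = (s \<otimes> t) \<otimes> (t \<otimes> b) \<oplus> (i \<otimes> t) \<otimes> b"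
      using c T.D_carr[OF b(1)] by algebra
    also have "\<dots> \<in> contraction t \<cdot> B"
      by (intro ideal_prod.sum ideal_prod.prod 1 2 b(1) T.D(6)[OF s(1) b(1)])
    finally show "y \<in> contraction t \<cdot> B" .
  qed
qed

text \<open>If \<open>xR = tB \<inter> R\<close>, extending to \<open>T\<close> gives \<open>xB = tB\<close>, so that \<open>t\<close> and \<open>x\<close> differ by a unit of
  \<open>T\<close>; and \<open>x\<close> is a unit modulo \<open>I\<close> in \<open>R\<close> because \<open>ts = 1 - i\<close> lies in \<open>tB \<inter> R = xR\<close>.\<close>

lemma contraction_principal_iff:
  assumes t: "unit_mod B t" and t0: "t \<noteq> \<zero>"
  shows "S.cls (contraction t) = \<one>\<^bsub>Cl K R\<^esub> \<longleftrightarrow> (\<exists>u\<in>Units TB. \<exists>r. unit_mod R r \<and> t = u \<otimes> r)"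
proof
  assume "\<exists>u\<in>Units TB. \<exists>r. unit_mod R r \<and> t = u \<otimes> r"
  then obtain u r where u: "u \<in> Units TB" and r: "unit_mod R r" and e: "t = u \<otimes> r" by blast
  have rB: "r \<in> B" and uB: "u \<in> B"
    using r u R_B unfolding unit_mod_def T.Units_iff by blast+
  have "contraction t = S.principal r" unfolding e contraction_unit[OF u rB] by (rule contraction_of_R[OF r])
  moreover have "r \<noteq> \<zero>" using e t0 T.D_carr[OF uB] by auto
  ultimately show "S.cls (contraction t) = \<one>\<^bsub>Cl K R\<^esub>" using cls_principal_R[OF r] by simp
next
  assume "S.cls (contraction t) = \<one>\<^bsub>Cl K R\<^esub>"
  then have "contraction t \<in> S.Prin" by (rule S.cls_eq_one_iff[THEN iffD1, OF contraction_invertible[OF t t0]])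
  then obtain x where x: "x \<in> fractions K R - {\<zero>}" and e: "contraction t = S.principal x"
    unfolding principal_ideals_def by blast
  have xc: "x \<in> carrier K" using x by (simp add: S.fractions_iff)
  have tc: "t \<in> carrier K" by (rule unit_mod_carr[OF t])
  have eT: "T.principal t = T.principal x" using ext_contraction[OF t] ext_principal[OF xc] e by simp
  have "t \<in> T.principal x" using T.principal_self[OF tc] eT by simp
  then obtain u where u: "u \<in> B" "t = u \<otimes> x" unfolding T.principal_eq by (rule imageE)
  have "x \<in> T.principal t" using T.principal_self[OF xc] eT by simp
  then obtain w where w: "w \<in> B" "x = w \<otimes> t" unfolding T.principal_eq by (rule imageE)
  have "(u \<otimes> w) \<otimes> t = u \<otimes> (w \<otimes> t)" using u(1) w(1) tc by (simp add: m_assoc)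
  also have "\<dots> = \<one> \<otimes> t" unfolding w(2)[symmetric] u(2)[symmetric] using tc by simp
  finally have "u \<otimes> w = \<one>" using m_rcancel[OF t0 tc, of "u \<otimes> w" \<one>] u(1) w(1) by simp
  then have uU: "u \<in> Units TB" using u w unfolding T.Units_iff by blast
  have xR: "x \<in> R" using S.principal_self[OF xc] unfolding e[symmetric] contraction_def by simp
  obtain s i where s: "t \<in> B" "s \<in> B" "i \<in> I" "t \<otimes> s \<oplus> i = \<one>" using t by (rule unit_modE)
  have c: "s \<in> carrier K" using s by simp
  have "t \<otimes> s \<in> R" using one_minus_R[OF s(4,3)] c tc by simp
  then have "s \<otimes> t \<in> contraction t" using s c tc by (intro contractionI) (simp_all add: m_comm)
  then obtain r' where r': "r' \<in> R" "s \<otimes> t = r' \<otimes> x" unfolding e S.principal_eq by (rule imageE)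
  have "x \<otimes> r' = t \<otimes> s" using r' c tc xc by (simp add: m_comm)
  then have "unit_mod R x" using unit_modI[OF xR r'(1) s(3)] s(4) by simp
  then show "\<exists>u\<in>Units TB. \<exists>r. unit_mod R r \<and> t = u \<otimes> r" using u(2) uU by blast
qed

section \<open>Ideals comaximal to the conductor\<close>

text \<open>With \<open>1 = j + i\<close>, an element \<open>y\<close> of \<open>JB \<inter> R\<close> is \<open>yj + yi\<close>. The first summand is in \<open>J\<close> because
  \<open>y \<in> R\<close>, the second because \<open>JB \<cdot> I \<subseteq> JI\<close>.\<close>

lemma comaximal_contraction_ext:
  assumes J: "fractional_ideal K R J" "J \<subseteq> R" and co: "comaximal SR J I"
  shows "(J \<cdot> B) \<inter> R = J"
proof
  have "\<one> \<in> J <+>\<^bsub>SR\<^esub> I" using co S.D(3) by (simp add: comaximal_def)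
  then obtain j i where j: "j \<in> J" "i \<in> I" "\<one> = j \<oplus> i" by (auto simp: set_add_def')
  have Jc: "J \<subseteq> carrier K" by (rule S.fractional_ideal_carr[OF J(1)])
  have JR: "r \<otimes> x \<in> J" if "r \<in> R" "x \<in> J" for r x
    using J(1) that unfolding S.fractional_ideal_iff by blast
  have JBI: "y \<otimes> i \<in> J" if "y \<in> J \<cdot> B" for y
    using that
  proof (induct rule: ideal_prod.induct)
    case (prod x b)
    then have "x \<in> carrier K" using Jc by blast
    then have "(x \<otimes> b) \<otimes> i = (i \<otimes> b) \<otimes> x" using prod I_carr[OF j(2)] by (simp add: m_ac)
    then show ?case using JR[OF I_mult_R[OF j(2) prod(2)] prod(1)] by simp
  next
    case (sum x y)
    then have "x \<in> carrier K" "y \<in> carrier K" using ideal_prod_closed[OF Jc B_carr] by blast+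
    then have "(x \<oplus> y) \<otimes> i = x \<otimes> i \<oplus> y \<otimes> i" using I_carr[OF j(2)] by (simp add: l_distr)
    then show ?case using sum S.fractional_ideal_add[OF J(1)] by simp
  qed
  show "(J \<cdot> B) \<inter> R \<subseteq> J"
  proof
    fix y assume y: "y \<in> (J \<cdot> B) \<inter> R"
    have jc: "j \<in> carrier K" using j Jc by blast
    have yc: "y \<in> carrier K" using y by simp
    have "y = y \<otimes> (j \<oplus> i)" using j(3)[symmetric] yc by simp
    also have "\<dots> = y \<otimes> j \<oplus> y \<otimes> i" using yc jc I_carr[OF j(2)] by (simp add: r_distr)
    also have "\<dots> \<in> J"
      by (rule S.fractional_ideal_add[OF J(1)]) (use y j JR JBI in auto)
    finally show "y \<in> J" .
  qed
  show "J \<subseteq> (J \<cdot> B) \<inter> R"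
  proof
    fix y assume y: "y \<in> J"
    then have "y \<in> carrier K" using Jc by blast
    then have "y \<in> J \<cdot> B" using ideal_prod.prod[OF y T.D(3), of K] by simp
    then show "y \<in> (J \<cdot> B) \<inter> R" using y J(2) by blast
  qed
qed

text \<open>A generator \<open>t\<close> of \<open>JB\<close> is a unit modulo \<open>I\<close> because \<open>j \<in> tB\<close> where \<open>1 = j + i\<close>.\<close>

lemma comaximal_principal_ext:
  assumes J: "invertible_ideal K R J" "J \<subseteq> R" and co: "comaximal SR J I"
    and principal: "J \<cdot> B \<in> T.Prin"
  obtains t where "unit_mod B t" "t \<noteq> \<zero>" "J = contraction t"
proof -
  obtain t where t: "t \<in> fractions K B - {\<zero>}" and e: "J \<cdot> B = T.principal t"
    using principal unfolding principal_ideals_def by blast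
  have tc: "t \<in> carrier K" using t by (simp add: T.fractions_iff)
  have fr: "fractional_ideal K R J" using J(1) by (simp add: invertible_ideal_def)
  have JB: "J \<cdot> B \<subseteq> B"
    using ideal_prod_mono[OF order_trans[OF J(2) R_sub_B] order_refl, of K B] ext_B by simp
  have tB: "t \<in> B" using T.principal_self[OF tc] JB e by blast
  have "\<one> \<in> J <+>\<^bsub>SR\<^esub> I" using co S.D(3) by (simp add: comaximal_def)
  then obtain j i where j: "j \<in> J" "i \<in> I" "\<one> = j \<oplus> i" by (auto simp: set_add_def')
  have "j \<in> carrier K" using j(1) J(2) by auto
  then have "j \<in> J \<cdot> B" using ideal_prod.prod[OF j(1) T.D(3), of K] by simp
  then obtain b where b: "b \<in> B" "j = b \<otimes> t" unfolding e T.principal_eq by (rule imageE)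
  have "t \<otimes> b \<oplus> i = \<one>" using b j(3) tc by (simp add: m_comm)
  then have "unit_mod B t" by (rule unit_modI[OF tB b(1) j(2)])
  moreover have "J = contraction t"
    using comaximal_contraction_ext[OF fr J(2) co] e by (simp add: contraction_def)
  ultimately show thesis using that t by blast
qed

text \<open>If \<open>LM = B\<close>, then \<open>R + MI\<close> is inverse to \<open>L \<inter> R\<close>: the product lies in \<open>R + LMI = R + I = R\<close>, and
  it contains \<open>L \<inter> R\<close> as well as \<open>(L \<inter> R)MI = (L \<inter> R)B \<cdot> MI = LMI = I\<close>, hence \<open>1 = l + i\<close>.\<close>

lemma comaximal_contraction_invertible:
  assumes L: "invertible_ideal K B L" "L \<subseteq> B" and co: "comaximal TB L I"
  shows "invertible_ideal K R (L \<inter> R)" "(L \<inter> R) \<cdot> B = L"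
proof -
  have "\<one> \<in> L <+>\<^bsub>TB\<^esub> I" using co T.D(3) by (simp add: comaximal_def)
  then obtain l i where l: "l \<in> L" "i \<in> I" "\<one> = l \<oplus> i" by (auto simp: set_add_def')
  obtain M where fL: "fractional_ideal K B L" and fM: "fractional_ideal K B M" and LM: "L \<cdot> M = B"
    using L(1) unfolding invertible_ideal_def by blast
  have lc: "l \<in> carrier K" using l(1) L(2) by auto
  have Lm: "b \<otimes> x \<in> L" if "b \<in> B" "x \<in> L" for b x
    using fL that unfolding T.fractional_ideal_iff by blast
  have Mm: "b \<otimes> x \<in> M" if "b \<in> B" "x \<in> M" for b x
    using fM that unfolding T.fractional_ideal_iff by blast
  have Mc: "M \<subseteq> carrier K" by (rule T.fractional_ideal_carr[OF fM])
  have Lc: "L \<subseteq> carrier K" by (rule T.fractional_ideal_carr[OF fL])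
  have lR: "l \<in> R" using one_minus_R[OF l(3)[symmetric] l(2) lc] .
  show ext: "(L \<inter> R) \<cdot> B = L"
  proof
    have "(L \<inter> R) \<cdot> B \<subseteq> L \<cdot> B" by (rule ideal_prod_mono) auto
    then show "(L \<inter> R) \<cdot> B \<subseteq> L" using T.ideal_prod_D(1)[OF fL] by simp
    show "L \<subseteq> (L \<inter> R) \<cdot> B"
    proof
      fix y assume y: "y \<in> L"
      then have yB: "y \<in> B" using L(2) by blast
      have 1: "i \<otimes> y \<in> L \<inter> R" using Lm[OF R_B[OF I_R[OF l(2)]] y] I_mult_R[OF l(2) yB] by blast
      have "y = (l \<oplus> i) \<otimes> y" using l(3)[symmetric] yB by simp
      also have "\<dots> = l \<otimes> y \<oplus> (i \<otimes> y) \<otimes> \<one>" using lc I_carr[OF l(2)] yB by (simp add: l_distr)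
      also have "\<dots> \<in> (L \<inter> R) \<cdot> B"
        by (intro ideal_prod.sum ideal_prod.prod 1 yB T.D(3)) (use l lR in blast)
      finally show "y \<in> (L \<inter> R) \<cdot> B" .
    qed
  qed
  let ?J = "L \<inter> R" and ?N = "set_add K R (M \<cdot> I)"
  have sgL: "subgroup L (add_monoid K)" and sgM: "subgroup M (add_monoid K)"
    using fL fM by (simp_all add: T.fractional_ideal_iff)
  have Ic: "I \<subseteq> carrier K" using I_carr by blast
  have MIc: "M \<cdot> I \<subseteq> carrier K" by (rule ideal_prod_closed[OF Mc Ic])
  have fJ: "fractional_ideal K R ?J"
    unfolding S.fractional_ideal_iff
  proof (intro conjI ballI bexI)
    show "subgroup ?J (add_monoid K)"
      by (rule add.subgroups_Inter_pair[OF sgL subring.axioms(1)[OF subring_R]])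
    show "d \<otimes> x \<in> ?J" if "d \<in> R" "x \<in> ?J" for d x
      using that Lm R_B S.D(6) by blast
    show "\<one> \<otimes> x \<in> R" if "x \<in> ?J" for x using that by simp
    show "\<one> \<in> R - {\<zero>}" using S.D(3) by simp
  qed
  have MI_mod: "r \<otimes> x \<in> M \<cdot> I" if r: "r \<in> B" and "x \<in> M \<cdot> I" for r x
    using that(2)
  proof (induct rule: ideal_prod.induct)
    case (prod m k)
    then have "m \<in> carrier K" using Mc by blast
    then have "r \<otimes> (m \<otimes> k) = (r \<otimes> m) \<otimes> k" using r I_carr[OF prod(2)] by (simp add: m_assoc)
    then show ?case using ideal_prod.prod[OF Mm[OF r prod(1)] prod(2), of K] by simp
  next
    case (sum x y)
    then have "x \<in> carrier K" "y \<in> carrier K" using MIc by blast+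
    then have "r \<otimes> (x \<oplus> y) = r \<otimes> x \<oplus> r \<otimes> y" using r by (simp add: r_distr)
    then show ?case using sum by (simp add: ideal_prod.sum)
  qed
  have J_MI: "x \<otimes> n \<in> I" if x: "x \<in> L" and "n \<in> M \<cdot> I" for x n
    using that(2)
  proof (induct rule: ideal_prod.induct)
    case (prod m k)
    then have "m \<in> carrier K" "x \<in> carrier K" using Mc Lc x by blast+
    then have "x \<otimes> (m \<otimes> k) = k \<otimes> (x \<otimes> m)" using I_carr[OF prod(2)] by (simp add: m_ac)
    moreover have "x \<otimes> m \<in> B" using ideal_prod.prod[OF x prod(1), of K] LM by simp
    ultimately show ?case using I_mult[OF prod(2)] by simp
  next
    case (sum n n')
    then have "n \<in> carrier K" "n' \<in> carrier K" "x \<in> carrier K" using MIc Lc x by blast+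
    then have "x \<otimes> (n \<oplus> n') = x \<otimes> n \<oplus> x \<otimes> n'" by (simp add: r_distr)
    then show ?case using sum I_add by simp
  qed
  have sgMI: "subgroup (M \<cdot> I) (add_monoid K)" by (rule ideal_prod_subgroup[OF sgM I_subgroup])
  have N_iff: "n \<in> ?N \<longleftrightarrow> (\<exists>r\<in>R. \<exists>m\<in>M \<cdot> I. n = r \<oplus> m)" for n
    by (auto simp: set_add_def')
  have J_N: "x \<otimes> n \<in> R" if x: "x \<in> ?J" and n: "n \<in> ?N" for x n
  proof -
    obtain r m where m: "r \<in> R" "m \<in> M \<cdot> I" "n = r \<oplus> m" using n unfolding N_iff by blast
    have mc: "m \<in> carrier K" using m MIc by blast
    have "x \<otimes> n = x \<otimes> r \<oplus> x \<otimes> m" using x m mc by (simp add: r_distr)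
    then show ?thesis using S.D(7)[OF S.D(6)] I_R[OF J_MI[OF _ m(2)]] x m(1) by simp
  qed
  \<comment> \<open>Any nonzero \<open>d \<in> L \<inter> R\<close> is a common denominator of \<open>R + MI\<close>.\<close>
  have "\<not> ?J \<subseteq> {\<zero>}"
  proof
    assume *: "?J \<subseteq> {\<zero>}"
    have "?J \<cdot> B \<subseteq> {\<zero>}"
      by (rule ideal_prod_least) (use * in auto)
    then have "L \<subseteq> {\<zero>}" using ext by simp
    then have "a \<otimes> b = \<zero>" if "a \<in> L" "b \<in> M" for a b
      using that Mc l_null[of b] by blast
    then have "L \<cdot> M \<subseteq> {\<zero>}" by (intro ideal_prod_least) simp_all
    then show False using LM T.D(3) one_not_zero by blast
  qed
  then obtain d where d: "d \<in> ?J" "d \<noteq> \<zero>" by blast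
  have fN: "fractional_ideal K R ?N"
    unfolding S.fractional_ideal_iff
  proof (intro conjI ballI bexI)
    show "subgroup ?N (add_monoid K)"
      unfolding set_add_def
      using add.mult_subgroups[OF subring.axioms(1)[OF subring_R] sgMI] .
    show "a \<otimes> n \<in> ?N" if a: "a \<in> R" and n: "n \<in> ?N" for a n
    proof -
      obtain r m where m: "r \<in> R" "m \<in> M \<cdot> I" "n = r \<oplus> m" using n unfolding N_iff by blast
      have mc: "m \<in> carrier K" using m MIc by blast
      have "a \<otimes> n = a \<otimes> r \<oplus> a \<otimes> m" using a m mc by (simp add: r_distr)
      then show ?thesis unfolding N_iff using S.D(6)[OF a m(1)] MI_mod[OF R_B[OF a] m(2)] by blast
    qed
    show "d \<otimes> n \<in> R" if "n \<in> ?N" for n using J_N[OF d(1) that] .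
    show "d \<in> R - {\<zero>}" using d by blast
  qed
  have "?J \<cdot> ?N = R"
  proof
    show "?J \<cdot> ?N \<subseteq> R"
      by (rule ideal_prod_least[OF J_N]) (use S.D(7) in auto)
    have N1: "\<one> \<in> ?N" unfolding N_iff
      using S.D(3) subgroup.one_closed[OF sgMI] by (intro bexI[of _ \<one>] bexI[of _ \<zero>]) simp_all
    have MI_N: "M \<cdot> I \<subseteq> ?N"
    proof
      fix m assume m: "m \<in> M \<cdot> I"
      then have "m = \<zero> \<oplus> m" using MIc by auto
      then show "m \<in> ?N" unfolding N_iff using m S.D(2) by blast
    qed
    have fP: "fractional_ideal K R (?J \<cdot> ?N)" by (rule S.fractional_ideal_prod[OF fJ fN])
    have l1: "l \<in> ?J \<cdot> ?N" using ideal_prod.prod[OF _ N1, of l ?J K] l(1) lR lc by simp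
    have "I \<subseteq> ?J \<cdot> (M \<cdot> I)"
    proof -
      have "?J \<cdot> (M \<cdot> I) = ?J \<cdot> (B \<cdot> (M \<cdot> I))"
      proof -
        have "B \<cdot> (M \<cdot> I) = (B \<cdot> M) \<cdot> I" using B_carr Mc Ic by (simp add: ideal_prod_assoc)
        then show ?thesis using T.ideal_prod_D(2)[OF fM] by simp
      qed
      also have "\<dots> = (?J \<cdot> B) \<cdot> (M \<cdot> I)"
        using Lc B_carr MIc by (intro ideal_prod_assoc[symmetric]) auto
      also have "\<dots> = (L \<cdot> M) \<cdot> I" using ext Lc Mc Ic by (simp add: ideal_prod_assoc)
      also have "\<dots> = B \<cdot> I" using LM by simp
      finally have *: "?J \<cdot> (M \<cdot> I) = B \<cdot> I" .
      show ?thesis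
      proof
        fix k assume k: "k \<in> I"
        then show "k \<in> ?J \<cdot> (M \<cdot> I)"
          using ideal_prod.prod[OF T.D(3) k, of K] I_carr[OF k] unfolding * by simp
      qed
    qed
    then have i1: "i \<in> ?J \<cdot> ?N" using ideal_prod_mono[OF order_refl MI_N, of K ?J] l(2) by blast
    have one: "\<one> \<in> ?J \<cdot> ?N" using S.fractional_ideal_add[OF fP l1 i1] l(3) by simp
    show "R \<subseteq> ?J \<cdot> ?N"
    proof
      fix r assume r: "r \<in> R"
      have "r \<otimes> \<one> \<in> ?J \<cdot> ?N" using fP r one unfolding S.fractional_ideal_iff by blast
      then show "r \<in> ?J \<cdot> ?N" using r by simp
    qed
  qed
  then show "invertible_ideal K R ?J" by (rule S.invertibleI[OF fJ fN])
qed

end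

section \<open>Units of the quotients by the conductor\<close>

lemma group_homI: "\<lbrakk>group G; group H; h \<in> hom G H\<rbrakk> \<Longrightarrow> group_hom G H h"
  by (simp add: group_hom_def group_hom_axioms_def)

context domain_extension
begin

abbreviation US :: "'a monoid" where "US \<equiv> units_of SR"
abbreviation UT :: "'a monoid" where "UT \<equiv> units_of TB"
abbreviation QS :: "'a set monoid" where "QS \<equiv> units_quot SR I"
abbreviation QT :: "'a set monoid" where "QT \<equiv> units_quot TB I"

lemma unit_mod_mem: "unit_mod D t \<Longrightarrow> t \<in> D"
  by (simp add: unit_mod_def)

lemma Units_QS_iff: "Y \<in> Units (SR Quot I) \<longleftrightarrow> (\<exists>r. unit_mod R r \<and> Y = I +> r)"
proof
  assume Y: "Y \<in> Units (SR Quot I)"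
  then have "Y \<in> carrier (SR Quot I)" by (simp add: Units_def)
  then obtain r where "r \<in> R" "Y = I +> r" by (auto simp: FactRing_def A_RCOSETS_def')
  then show "\<exists>r. unit_mod R r \<and> Y = I +> r" using Y Units_S_iff by blast
qed (auto simp: Units_S_iff unit_mod_mem)

lemma Units_QT_iff: "Y \<in> Units (TB Quot I) \<longleftrightarrow> (\<exists>t. unit_mod B t \<and> Y = I +> t)"
proof
  assume Y: "Y \<in> Units (TB Quot I)"
  then have "Y \<in> carrier (TB Quot I)" by (simp add: Units_def)
  then obtain r where "r \<in> B" "Y = I +> r" by (auto simp: FactRing_def A_RCOSETS_def')
  then show "\<exists>t. unit_mod B t \<and> Y = I +> t" using Y Units_T_iff by blast
qed (auto simp: Units_T_iff unit_mod_mem)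

lemma QS_mult: "\<lbrakk>a \<in> R; b \<in> R\<rbrakk> \<Longrightarrow> (I +> a) \<otimes>\<^bsub>QS\<^esub> (I +> b) = I +> (a \<otimes> b)"
  using ideal.rcoset_mult_add[OF I_ideal_S, of a b] by (simp add: units_of_mult FactRing_def)

lemma QT_mult: "\<lbrakk>a \<in> B; b \<in> B\<rbrakk> \<Longrightarrow> (I +> a) \<otimes>\<^bsub>QT\<^esub> (I +> b) = I +> (a \<otimes> b)"
  using ideal.rcoset_mult_add[OF I_ideal_T, of a b] by (simp add: units_of_mult FactRing_def)

lemma QT_one: "\<one>\<^bsub>QT\<^esub> = I +> \<one>"
  by (simp add: units_of_one FactRing_def)

lemma zero_unit_mod: "unit_mod B \<zero> \<Longrightarrow> \<one> \<in> I"
proof -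
  assume "unit_mod B \<zero>"
  then obtain s i where "s \<in> B" "i \<in> I" "\<zero> \<otimes> s \<oplus> i = \<one>" by (rule unit_modE)
  then show "\<one> \<in> I" using I_carr[of i] by simp
qed

lemma unit_mod_one: "unit_mod B \<one>" "unit_mod R \<one>"
proof -
  have "\<zero> \<in> I" using subgroup.one_closed[OF I_subgroup] by simp
  then show "unit_mod B \<one>" "unit_mod R \<one>"
    by (auto intro!: unit_modI[of _ _ \<one> \<zero>] S.D(3) T.D(3))
qed

text \<open>The map \<open>\<sigma>\<close> is described by nonzero representatives only. The zero coset is a unit only if \<open>1 \<in> I\<close>,
  and then \<open>1\<close> represents it.\<close>

lemma nonzero_representative:
  assumes "unit_mod B t"
  obtains t' where "unit_mod B t'" "t' \<noteq> \<zero>" "I +> t = I +> t'"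
proof (cases "t = \<zero>")
  case True
  have one: "\<one> \<in> I" using assms zero_unit_mod True by simp
  have "\<exists>i\<in>I. \<one> = i \<oplus> \<zero>" by (rule bexI[OF _ one]) simp
  then have "I +> \<one> = I +> t" using coset_eq_iff[OF T.D(3) T.D(2)] True by simp
  then show thesis using that[OF unit_mod_one(1)] one_not_zero by simp
qed (use that assms in blast)

lemma carrier_QTE:
  assumes "Y \<in> carrier QT"
  obtains t where "unit_mod B t" "t \<noteq> \<zero>" "Y = I +> t"
proof -
  obtain t where t: "unit_mod B t" "Y = I +> t"
    using assms by (auto simp: units_of_carrier Units_QT_iff)
  show thesis by (rule nonzero_representative[OF t(1)]) (use that t(2) in simp)
qed

section \<open>The values of the maps\<close>

lemma psi_eq:
  assumes u: "u \<in> B" and r: "r \<in> R"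
  shows "seq_psi TB R (u, I +> r) = I +> (u \<otimes> r)"
proof -
  have *: "I +> (u \<otimes> r') = I +> (u \<otimes> r)" if r': "r' \<in> I +> r" for r'
  proof -
    obtain i where i: "i \<in> I" "r' = i \<oplus> r" using r' by (auto simp: mem_rcos)
    have c: "u \<in> carrier K" "r \<in> carrier K" "i \<in> carrier K" using u r I_carr[OF i(1)] by simp_all
    have e: "u \<otimes> r' = i \<otimes> u \<oplus> u \<otimes> r" unfolding i(2) using c by algebra
    have uB: "u \<otimes> r \<in> B" and iB: "i \<otimes> u \<in> I" using T.D(6) u R_B[OF r] I_mult[OF i(1) u] by blast+
    have "u \<otimes> r' \<in> B" unfolding e using T.D(7) uB R_B[OF I_R[OF iB]] by blast
    then show ?thesis using coset_eq_iff uB e iB by blast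
  qed
  have "\<zero> \<in> I" using subgroup.one_closed[OF I_subgroup] by simp
  then have "r \<in> I +> r" unfolding mem_rcos using r by (intro bexI[of _ \<zero>]) simp_all
  then have ne: "I +> r \<noteq> {}" by blast
  have "seq_psi TB R (u, I +> r) = the_elem ((\<lambda>r'. I +> (u \<otimes> r')) ` (I +> r))"
    by (simp add: seq_psi_def)
  also have "\<dots> = I +> (u \<otimes> r)" by (rule the_elem_image_unique[OF ne *])
  finally show ?thesis .
qed

lemma sigma_eq:
  assumes t: "unit_mod B t" and t0: "t \<noteq> \<zero>"
  shows "seq_sigma K TB R (I +> t) = S.cls (contraction t)"
proof -
  have *: "S.cls (contraction t') = S.cls (contraction t)" if t': "t' \<in> I +> t" "t' \<noteq> \<zero>" for t'
  proof -
    obtain i where i: "i \<in> I" "t' = i \<oplus> t" using t'(1) by (auto simp: mem_rcos)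
    have "t' \<in> B" using T.D(7) R_B[OF I_R[OF i(1)]] unit_mod_mem[OF t] i(2) by simp
    moreover from this have "I +> t' = I +> t"
      using coset_eq_iff[OF _ unit_mod_mem[OF t]] i by blast
    ultimately have "unit_mod B t'"
      using Units_T_iff[of t'] Units_T_iff[OF unit_mod_mem[OF t]] t by simp
    then show ?thesis using contraction_cls_cong[OF t t0] that(2) i by blast
  qed
  have "\<zero> \<in> I" using subgroup.one_closed[OF I_subgroup] by simp
  then have "t \<in> I +> t"
    unfolding mem_rcos using unit_mod_carr[OF t] by (intro bexI[of _ \<zero>]) simp_all
  then have ne: "(I +> t) - {\<zero>\<^bsub>TB\<^esub>} \<noteq> {}" using t0 by auto
  have "seq_sigma K TB R (I +> t) = the_elem ((\<lambda>t. S.cls (contraction t)) ` ((I +> t) - {\<zero>\<^bsub>TB\<^esub>}))"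
    by (simp add: seq_sigma_def contraction_def)
  also have "\<dots> = S.cls (contraction t)" by (rule the_elem_image_unique[OF ne *]) simp_all
  finally show ?thesis .
qed

text \<open>Another representative is \<open>xJ\<close> with \<open>x\<close> in the quotient field of \<open>R\<close>, and \<open>(xJ)B = xB \<cdot> JB\<close>.\<close>

lemma tau_eq:
  assumes J: "invertible_ideal K R J"
  shows "seq_tau K TB (S.cls J) = T.cls (J \<cdot> B)"
proof -
  interpret Cl: comm_group "Cl K B" by (rule T.Cl_comm_group)
  have *: "T.cls (L \<cdot> B) = T.cls (J \<cdot> B)" if L: "L \<in> S.cls J" for L
  proof -
    obtain x where x: "x \<in> fractions K R - {\<zero>}" "L = S.principal x \<cdot> J"
      using S.mem_cls(3)[OF J L] by blast
    have xc: "x \<in> carrier K" using x by (simp add: S.fractions_iff)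
    have x': "x \<in> fractions K B - {\<zero>}" by (rule nonzero_fractions[OF x(1)])
    have "L \<cdot> B = T.principal x \<cdot> (J \<cdot> B)"
      using ext_prod[OF S.invertible_carr[OF S.invertible_principal[OF x(1)]] S.invertible_carr[OF J]]
        ext_principal[OF xc] x(2) by simp
    then have "T.cls (L \<cdot> B) = T.cls (T.principal x) \<otimes>\<^bsub>Cl K B\<^esub> T.cls (J \<cdot> B)"
      using T.cls_prod[OF T.invertible_principal[OF x'] ext_invertible[OF J]] by simp
    then show ?thesis using T.cls_principal[OF x'] T.cls_closed[OF ext_invertible[OF J]] by simp
  qed
  have "seq_tau K TB (S.cls J) = the_elem ((\<lambda>J. T.cls (J \<cdot> B)) ` S.cls J)"
    by (simp add: seq_tau_def)
  also have "\<dots> = T.cls (J \<cdot> B)"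
    by (rule the_elem_image_unique[OF _ *]) (use S.cls_self[OF J] in blast)
  finally show ?thesis .
qed

lemma phi_eq: "\<lbrakk>v \<in> R; w \<in> R; v \<otimes> w = \<one>\<rbrakk> \<Longrightarrow> seq_phi TB R v = (v, I +> w)"
  using S.inv_eq[of v w] by (simp add: seq_phi_def)

lemma well_defined: "seq_well_defined K TB R"
proof -
  have 1: "seq_psi TB R (u, I +> r) = I +> (u \<otimes> r)" if "u \<in> Units TB" "r \<in> R" for u r
    using psi_eq that by (simp add: T.Units_iff)
  have 2: "seq_sigma K TB R (I +> t) = ideal_class K R (T.principal t \<inter> R)"
    if "t \<in> B" "t \<noteq> \<zero>" "I +> t \<in> Units (TB Quot I)" for t
    using sigma_eq[of t] that Units_T_iff by (simp add: contraction_def)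
  show ?thesis unfolding seq_well_defined_def Let_def using 1 2 tau_eq by simp
qed

section \<open>The homomorphisms\<close>

lemma groups: "group US" "group UT" "group QS" "group QT" "group (UT \<times>\<times> QS)"
proof -
  show "group US" "group UT"
    using cring.axioms(1) ring.is_monoid monoid.units_group S.cring_D T.cring_D by blast+
  moreover show "group QS" "group QT"
    using ideal.quotient_is_ring ring.is_monoid monoid.units_group I_ideal_S I_ideal_T by blast+
  ultimately show "group (UT \<times>\<times> QS)" using DirProd_group by blast
qed

lemma Cl_groups: "group (Cl K R)" "group (Cl K B)"
  using comm_group.axioms(2) S.Cl_comm_group T.Cl_comm_group by blast+

lemma unit_mod_units_mult: "\<lbrakk>u \<in> Units TB; unit_mod R r\<rbrakk> \<Longrightarrow> unit_mod B (u \<otimes> r)"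
proof -
  assume "u \<in> Units TB" "unit_mod R r"
  moreover from this(1) obtain w where "u \<in> B" "w \<in> B" "u \<otimes> w = \<one>" unfolding T.Units_iff by blast
  moreover have "\<zero> \<in> I" using subgroup.one_closed[OF I_subgroup] by simp
  ultimately have "unit_mod B u" by (intro unit_modI[of u B w \<zero>]) simp_all
  then show ?thesis
    using unit_mod_mult[OF R_sub_B order_refl T.field_subring_axioms] unit_mod_R_B \<open>unit_mod R r\<close> by blast
qed

lemma phi_hom: "group_hom US (UT \<times>\<times> QS) (seq_phi TB R)"
proof (rule group_homI[OF groups(1) groups(5)], rule homI)
  fix v assume "v \<in> carrier US"
  then obtain w where w: "v \<in> R" "w \<in> R" "v \<otimes> w = \<one>" by (auto simp: units_of_carrier S.Units_iff)
  have "\<zero> \<in> I" using subgroup.one_closed[OF I_subgroup] by simp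
  then have "unit_mod R w" using w by (intro unit_modI[of w R v \<zero>]) (simp_all add: m_comm)
  moreover have "v \<in> Units TB" unfolding T.Units_iff using w R_B by blast
  ultimately show "seq_phi TB R v \<in> carrier (UT \<times>\<times> QS)"
    unfolding phi_eq[OF w] by (auto simp: units_of_carrier DirProd_def Units_QS_iff)
next
  fix v v' assume "v \<in> carrier US" "v' \<in> carrier US"
  then obtain w w' where w: "v \<in> R" "w \<in> R" "v \<otimes> w = \<one>" and w': "v' \<in> R" "w' \<in> R" "v' \<otimes> w' = \<one>"
    by (auto simp: units_of_carrier S.Units_iff)
  have "(v \<otimes> v') \<otimes> (w \<otimes> w') = (v \<otimes> w) \<otimes> (v' \<otimes> w')" using w(1,2) w'(1,2) by (simp add: m_ac)
  then have "(v \<otimes> v') \<otimes> (w \<otimes> w') = \<one>" using w w' by simp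
  then have "seq_phi TB R (v \<otimes> v') = (v \<otimes> v', I +> (w \<otimes> w'))"
    using phi_eq S.D(6) w w' by blast
  then show "seq_phi TB R (v \<otimes>\<^bsub>US\<^esub> v') = seq_phi TB R v \<otimes>\<^bsub>UT \<times>\<times> QS\<^esub> seq_phi TB R v'"
    unfolding phi_eq[OF w] phi_eq[OF w']
    using QS_mult[OF w(2) w'(2)] by (simp add: DirProd_def units_of_mult)
qed

lemma psi_hom: "group_hom (UT \<times>\<times> QS) QT (seq_psi TB R)"
proof (rule group_homI[OF groups(5) groups(4)], rule homI)
  fix p assume "p \<in> carrier (UT \<times>\<times> QS)"
  then obtain u r where u: "u \<in> Units TB" and r: "unit_mod R r" and p: "p = (u, I +> r)"
    by (auto simp: units_of_carrier Units_QS_iff)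
  have "u \<in> B" using u by (simp add: T.Units_iff)
  then show "seq_psi TB R p \<in> carrier QT"
    unfolding p psi_eq[OF _ unit_mod_mem[OF r]] units_of_carrier Units_QT_iff
    using psi_eq[OF _ unit_mod_mem[OF r]] unit_mod_units_mult[OF u r] by auto
next
  fix p p' assume "p \<in> carrier (UT \<times>\<times> QS)" "p' \<in> carrier (UT \<times>\<times> QS)"
  then obtain u r u' r' where u: "u \<in> Units TB" and r: "unit_mod R r" and p: "p = (u, I +> r)"
    and u': "u' \<in> Units TB" and r': "unit_mod R r'" and p': "p' = (u', I +> r')"
    by (auto simp: units_of_carrier Units_QS_iff)
  note m = unit_mod_mem[OF r] unit_mod_mem[OF r']
  have b: "u \<in> B" "u' \<in> B" using u u' by (simp_all add: T.Units_iff)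
  have "p \<otimes>\<^bsub>UT \<times>\<times> QS\<^esub> p' = (u \<otimes> u', I +> (r \<otimes> r'))"
    unfolding p p' using QS_mult[OF m] by (simp add: units_of_mult)
  moreover have "(u \<otimes> u') \<otimes> (r \<otimes> r') = (u \<otimes> r) \<otimes> (u' \<otimes> r')" using b m by (simp add: m_ac)
  moreover have "(I +> (u \<otimes> r)) \<otimes>\<^bsub>QT\<^esub> (I +> (u' \<otimes> r')) = I +> ((u \<otimes> r) \<otimes> (u' \<otimes> r'))"
    using QT_mult T.D(6) b m R_B by blast
  ultimately show "seq_psi TB R (p \<otimes>\<^bsub>UT \<times>\<times> QS\<^esub> p') = seq_psi TB R p \<otimes>\<^bsub>QT\<^esub> seq_psi TB R p'"
    unfolding p p' using psi_eq b m T.D(6)[OF b] S.D(6)[OF m] by simp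
qed

lemma sigma_hom: "group_hom QT (Cl K R) (seq_sigma K TB R)"
proof (rule group_homI[OF groups(4) Cl_groups(1)], rule homI)
  fix Y assume "Y \<in> carrier QT"
  then obtain t where t: "unit_mod B t" "t \<noteq> \<zero>" "Y = I +> t"
    by (rule carrier_QTE)
  then show "seq_sigma K TB R Y \<in> carrier (Cl K R)"
    using sigma_eq[OF t(1,2)] S.cls_closed[OF contraction_invertible[OF t(1,2)]] by simp
next
  fix Y Y' assume Y: "Y \<in> carrier QT" and Y': "Y' \<in> carrier QT"
  obtain t where t: "unit_mod B t" "t \<noteq> \<zero>" "Y = I +> t" using Y by (rule carrier_QTE)
  obtain t' where t': "unit_mod B t'" "t' \<noteq> \<zero>" "Y' = I +> t'" using Y' by (rule carrier_QTE)
  have m: "unit_mod B (t \<otimes> t')"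
    by (rule unit_mod_mult[OF R_sub_B order_refl T.field_subring_axioms t(1) t'(1)])
  have "t \<otimes> t' \<noteq> \<zero>" using t t' integral_iff unit_mod_carr by blast
  then have "seq_sigma K TB R (I +> (t \<otimes> t')) = S.cls (contraction t \<cdot> contraction t')"
    using sigma_eq[OF m] contraction_mult[OF t(1) t'(1)] by simp
  also have "\<dots> = S.cls (contraction t) \<otimes>\<^bsub>Cl K R\<^esub> S.cls (contraction t')"
    by (rule S.cls_prod[OF contraction_invertible[OF t(1,2)] contraction_invertible[OF t'(1,2)]])
  finally show "seq_sigma K TB R (Y \<otimes>\<^bsub>QT\<^esub> Y') =
      seq_sigma K TB R Y \<otimes>\<^bsub>Cl K R\<^esub> seq_sigma K TB R Y'"
    unfolding t(3) t'(3) QT_mult[OF unit_mod_mem[OF t(1)] unit_mod_mem[OF t'(1)]]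
      sigma_eq[OF t(1,2)] sigma_eq[OF t'(1,2)] .
qed

lemma tau_hom: "group_hom (Cl K R) (Cl K B) (seq_tau K TB)"
proof (rule group_homI[OF Cl_groups], rule homI)
  fix C assume "C \<in> carrier (Cl K R)"
  then obtain J where J: "invertible_ideal K R J" "C = S.cls J" by (auto simp: S.carrier_Cl)
  then show "seq_tau K TB C \<in> carrier (Cl K B)"
    using tau_eq[OF J(1)] T.cls_closed[OF ext_invertible[OF J(1)]] by simp
next
  fix C C' assume "C \<in> carrier (Cl K R)" "C' \<in> carrier (Cl K R)"
  then obtain J J' where J: "invertible_ideal K R J" "C = S.cls J"
    and J': "invertible_ideal K R J'" "C' = S.cls J'" by (auto simp: S.carrier_Cl)
  have "seq_tau K TB (S.cls (J \<cdot> J')) = T.cls ((J \<cdot> B) \<cdot> (J' \<cdot> B))"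
    using tau_eq[OF S.invertible_prod[OF J(1) J'(1)]]
      ext_prod[OF S.invertible_carr[OF J(1)] S.invertible_carr[OF J'(1)]] by simp
  then show "seq_tau K TB (C \<otimes>\<^bsub>Cl K R\<^esub> C') = seq_tau K TB C \<otimes>\<^bsub>Cl K B\<^esub> seq_tau K TB C'"
    unfolding J(2) J'(2) S.cls_prod[OF J(1) J'(1), symmetric] tau_eq[OF J(1)] tau_eq[OF J'(1)]
      T.cls_prod[OF ext_invertible[OF J(1)] ext_invertible[OF J'(1)], symmetric] .
qed

lemma homs: "seq_homs K TB R"
proof -
  have i: "group_hom (singleton_group ()) US (seq_iota TB)"
  proof (rule group_homI[OF singleton_group groups(1)], rule homI)
    show "seq_iota TB x \<in> carrier US" for x
      using S.D(3) by (auto simp: seq_iota_def units_of_carrier S.Units_iff)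
    show "seq_iota TB (x \<otimes>\<^bsub>singleton_group ()\<^esub> y) = seq_iota TB x \<otimes>\<^bsub>US\<^esub> seq_iota TB y" for x y
      by (simp add: seq_iota_def units_of_mult)
  qed
  have p: "group_hom (Cl K B) (singleton_group ()) seq_pi"
    by (rule group_homI[OF Cl_groups(2) singleton_group]) (simp add: hom_def singleton_group_def)
  show ?thesis
    unfolding seq_homs_def Let_def
    using i phi_hom psi_hom sigma_hom tau_hom p by simp
qed

section \<open>Exactness\<close>

lemma exact_at_units: "seq_iota TB ` carrier (singleton_group ()) = kernel US (UT \<times>\<times> QS) (seq_phi TB R)"
proof -
  have "v = \<one>" if "v \<in> kernel US (UT \<times>\<times> QS) (seq_phi TB R)" for v
    using that by (simp add: kernel_def seq_phi_def DirProd_def units_of_one)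
  moreover have "\<one> \<in> kernel US (UT \<times>\<times> QS) (seq_phi TB R)"
    using group_hom.hom_one[OF phi_hom] group.is_monoid[OF groups(1), THEN monoid.one_closed]
    by (simp add: kernel_def units_of_one)
  ultimately have "kernel US (UT \<times>\<times> QS) (seq_phi TB R) = {\<one>}" by blast
  then show ?thesis by (simp add: seq_iota_def)
qed

text \<open>Let \<open>ur = 1 + i\<close>. Then \<open>ur \<in> R\<close>, and with \<open>rr' + j = 1\<close> also \<open>u = ur \<cdot> r' + ju\<close> is in \<open>R\<close>. For
  the inverse \<open>w\<close> of \<open>u\<close> one has \<open>r = iw + w\<close>, so \<open>w\<close> is in \<open>R\<close> too and has the same coset as \<open>r\<close>.\<close>

lemma exact_at_product: "seq_phi TB R ` carrier US = kernel (UT \<times>\<times> QS) QT (seq_psi TB R)"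
proof
  show "seq_phi TB R ` carrier US \<subseteq> kernel (UT \<times>\<times> QS) QT (seq_psi TB R)"
  proof
    fix p assume "p \<in> seq_phi TB R ` carrier US"
    then obtain v where v: "v \<in> carrier US" and p: "p = seq_phi TB R v" by blast
    then obtain w where w: "v \<in> R" "w \<in> R" "v \<otimes> w = \<one>" by (auto simp: units_of_carrier S.Units_iff)
    have "p \<in> carrier (UT \<times>\<times> QS)" unfolding p by (rule group_hom.hom_closed[OF phi_hom v])
    moreover have "seq_psi TB R p = \<one>\<^bsub>QT\<^esub>"
      unfolding p phi_eq[OF w] psi_eq[OF R_B[OF w(1)] w(2)] w(3) QT_one ..
    ultimately show "p \<in> kernel (UT \<times>\<times> QS) QT (seq_psi TB R)" by (simp add: kernel_def)
  qed
  show "kernel (UT \<times>\<times> QS) QT (seq_psi TB R) \<subseteq> seq_phi TB R ` carrier US"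
  proof
    fix p assume p: "p \<in> kernel (UT \<times>\<times> QS) QT (seq_psi TB R)"
    then have "p \<in> carrier (UT \<times>\<times> QS)" by (simp add: kernel_def)
    then obtain u r where u: "u \<in> Units TB" and r: "unit_mod R r" and pe: "p = (u, I +> r)"
      by (auto simp: units_of_carrier Units_QS_iff)
    obtain w where w: "u \<in> B" "w \<in> B" "u \<otimes> w = \<one>" using u unfolding T.Units_iff by blast
    obtain r' j where r': "r \<in> R" "r' \<in> R" "j \<in> I" "r \<otimes> r' \<oplus> j = \<one>" using r by (rule unit_modE)
    have "I +> (u \<otimes> r) = I +> \<one>"
      using p unfolding pe kernel_def using psi_eq[OF w(1) r'(1)] QT_one by simp
    then obtain i where i: "i \<in> I" "u \<otimes> r = i \<oplus> \<one>"
      using coset_eq_iff[OF T.D(6)[OF w(1) R_B[OF r'(1)]] T.D(3)] by blast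
    have c: "u \<in> carrier K" "w \<in> carrier K" "r \<in> carrier K" "r' \<in> carrier K" "j \<in> carrier K" "i \<in> carrier K"
      using w r' I_carr i by simp_all
    have urR: "u \<otimes> r \<in> R" unfolding i(2) using S.D(3,7) I_R[OF i(1)] by blast
    have "u = u \<otimes> (r \<otimes> r' \<oplus> j)" unfolding r'(4) using c by simp
    also have "\<dots> = (u \<otimes> r) \<otimes> r' \<oplus> j \<otimes> u" using c by algebra
    also have "\<dots> \<in> R" using S.D(7)[OF S.D(6)[OF urR r'(2)] I_mult_R[OF r'(3) w(1)]] .
    finally have uR: "u \<in> R" .
    have "r = (u \<otimes> w) \<otimes> r" unfolding w(3) using c by simp
    also have "\<dots> = w \<otimes> (u \<otimes> r)" using c by (simp add: m_ac)
    also have "\<dots> = i \<otimes> w \<oplus> w" unfolding i(2) using c by algebra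
    finally have rw: "r = i \<otimes> w \<oplus> w" .
    have "w = r \<oplus> \<ominus> (i \<otimes> w)" unfolding rw using c(2,6) by algebra
    also have "\<dots> \<in> R" using S.D(7)[OF r'(1) S.D(5)[OF I_mult_R[OF i(1) w(2)]]] .
    finally have wR: "w \<in> R" .
    have "I +> r = I +> w"
      using coset_eq_iff[OF R_B[OF r'(1)] w(2)] I_mult[OF i(1) w(2)] rw by blast
    then have "p = seq_phi TB R u" unfolding pe phi_eq[OF uR wR w(3)] by simp
    moreover have "u \<in> carrier US" unfolding units_of_carrier S.Units_iff using uR wR w(3) by blast
    ultimately show "p \<in> seq_phi TB R ` carrier US" by blast
  qed
qed

text \<open>The pairs \<open>(u, r + I)\<close> map to the cosets of the elements \<open>ur\<close>, which are those that
  \<open>contraction_principal_iff\<close> identifies. Only \<open>ur = 0\<close> has to be treated apart.\<close>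

lemma exact_at_quotient_units:
  "seq_psi TB R ` carrier (UT \<times>\<times> QS) = kernel QT (Cl K R) (seq_sigma K TB R)"
proof
  show "seq_psi TB R ` carrier (UT \<times>\<times> QS) \<subseteq> kernel QT (Cl K R) (seq_sigma K TB R)"
  proof
    fix Y assume "Y \<in> seq_psi TB R ` carrier (UT \<times>\<times> QS)"
    then obtain p where p: "p \<in> carrier (UT \<times>\<times> QS)" and Y: "Y = seq_psi TB R p" by blast
    then obtain u r where u: "u \<in> Units TB" and r: "unit_mod R r" and pe: "p = (u, I +> r)"
      by (auto simp: units_of_carrier Units_QS_iff)
    have YQ: "Y \<in> carrier QT" unfolding Y by (rule group_hom.hom_closed[OF psi_hom p])
    have Ye: "Y = I +> (u \<otimes> r)"
      unfolding Y pe using psi_eq[OF _ unit_mod_mem[OF r]] u by (simp add: T.Units_iff)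
    have m: "unit_mod B (u \<otimes> r)" by (rule unit_mod_units_mult[OF u r])
    obtain t where t: "unit_mod B t" "t \<noteq> \<zero>" "Y = I +> t" "\<exists>u\<in>Units TB. \<exists>r. unit_mod R r \<and> t = u \<otimes> r"
    proof (cases "u \<otimes> r = \<zero>")
      case True
      then have one: "\<one> \<in> I" using m zero_unit_mod by simp
      have "\<exists>i\<in>I. \<one> = i \<oplus> u \<otimes> r" by (rule bexI[OF _ one]) (simp add: True)
      then have "Y = I +> \<one>" using coset_eq_iff[OF T.D(3) unit_mod_mem[OF m]] Ye by simp
      moreover have "\<exists>u\<in>Units TB. \<exists>r. unit_mod R r \<and> \<one> = u \<otimes> r"
        using unit_mod_one(2) T.D(3) by (intro bexI[of _ \<one>] exI[of _ \<one>]) (auto simp: T.Units_iff)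
      ultimately show thesis using that[OF unit_mod_one(1)] one_not_zero by simp
    next
      case False
      then show thesis using that[OF m] Ye u r by blast
    qed
    have "seq_sigma K TB R Y = \<one>\<^bsub>Cl K R\<^esub>"
      unfolding t(3) sigma_eq[OF t(1,2)] contraction_principal_iff[OF t(1,2)] by (rule t(4))
    then show "Y \<in> kernel QT (Cl K R) (seq_sigma K TB R)" using YQ by (simp add: kernel_def)
  qed
  show "kernel QT (Cl K R) (seq_sigma K TB R) \<subseteq> seq_psi TB R ` carrier (UT \<times>\<times> QS)"
  proof
    fix Y assume Y: "Y \<in> kernel QT (Cl K R) (seq_sigma K TB R)"
    then have "Y \<in> carrier QT" by (simp add: kernel_def)
    then obtain t where t: "unit_mod B t" "t \<noteq> \<zero>" "Y = I +> t"
      by (rule carrier_QTE)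
    have "S.cls (contraction t) = \<one>\<^bsub>Cl K R\<^esub>"
      using Y sigma_eq[OF t(1,2)] t(3) by (simp add: kernel_def)
    then obtain u r where u: "u \<in> Units TB" and r: "unit_mod R r" and e: "t = u \<otimes> r"
      unfolding contraction_principal_iff[OF t(1,2)] by blast
    have "Y = seq_psi TB R (u, I +> r)"
      using psi_eq[OF _ unit_mod_mem[OF r]] u t(3) e by (simp add: T.Units_iff)
    moreover have "(u, I +> r) \<in> carrier (UT \<times>\<times> QS)"
      using u r by (auto simp: units_of_carrier Units_QS_iff)
    ultimately show "Y \<in> seq_psi TB R ` carrier (UT \<times>\<times> QS)" by blast
  qed
qed

lemma sigma_in_kernel_tau:
  assumes t: "unit_mod B t" and t0: "t \<noteq> \<zero>"
  shows "S.cls (contraction t) \<in> kernel (Cl K R) (Cl K B) (seq_tau K TB)"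
proof -
  have "seq_tau K TB (S.cls (contraction t)) = T.cls (T.principal t)"
    using tau_eq[OF contraction_invertible[OF t t0]] ext_contraction[OF t] by simp
  also have "\<dots> = \<one>\<^bsub>Cl K B\<^esub>"
    by (rule T.cls_principal) (use t0 B_fractions[OF unit_mod_mem[OF t]] in simp)
  finally show ?thesis
    using S.cls_closed[OF contraction_invertible[OF t t0]] by (simp add: kernel_def)
qed

lemma sigma_image:
  "seq_sigma K TB R ` carrier QT = {S.cls (contraction t) | t. unit_mod B t \<and> t \<noteq> \<zero>}"
proof
  show "seq_sigma K TB R ` carrier QT \<subseteq> {S.cls (contraction t) | t. unit_mod B t \<and> t \<noteq> \<zero>}"
  proof
    fix C assume "C \<in> seq_sigma K TB R ` carrier QT"
    then obtain Y where Y: "Y \<in> carrier QT" "C = seq_sigma K TB R Y" by blast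
    from Y(1) obtain t where t: "unit_mod B t" "t \<noteq> \<zero>" "Y = I +> t"
      by (rule carrier_QTE)
    then show "C \<in> {S.cls (contraction t) | t. unit_mod B t \<and> t \<noteq> \<zero>}"
      using Y sigma_eq[OF t(1,2)] by blast
  qed
  show "{S.cls (contraction t) | t. unit_mod B t \<and> t \<noteq> \<zero>} \<subseteq> seq_sigma K TB R ` carrier QT"
  proof
    fix C assume "C \<in> {S.cls (contraction t) | t. unit_mod B t \<and> t \<noteq> \<zero>}"
    then obtain t where t: "unit_mod B t" "t \<noteq> \<zero>" "C = S.cls (contraction t)" by blast
    have "I +> t \<in> carrier QT" unfolding units_of_carrier Units_QT_iff using t(1) by blast
    then show "C \<in> seq_sigma K TB R ` carrier QT"
      by (rule rev_image_eqI) (simp add: t(3) sigma_eq[OF t(1,2)])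
  qed
qed

lemma exact_at_Cl:
  assumes rep: "\<And>C. C \<in> kernel (Cl K R) (Cl K B) (seq_tau K TB) \<Longrightarrow> \<exists>J\<in>C. J \<subseteq> R \<and> comaximal SR J I"
  shows "seq_sigma K TB R ` carrier QT = kernel (Cl K R) (Cl K B) (seq_tau K TB)"
proof
  show "seq_sigma K TB R ` carrier QT \<subseteq> kernel (Cl K R) (Cl K B) (seq_tau K TB)"
    unfolding sigma_image using sigma_in_kernel_tau by blast
  show "kernel (Cl K R) (Cl K B) (seq_tau K TB) \<subseteq> seq_sigma K TB R ` carrier QT"
  proof
    fix C assume C: "C \<in> kernel (Cl K R) (Cl K B) (seq_tau K TB)"
    obtain J where J: "J \<in> C" "J \<subseteq> R" "comaximal SR J I" using rep[OF C] by blast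
    obtain J' where J': "invertible_ideal K R J'" "C = S.cls J'"
      using C by (auto simp: kernel_def S.carrier_Cl)
    have inv: "invertible_ideal K R J" and CJ: "C = S.cls J"
      using S.mem_cls(1,2)[OF J'(1)] J(1) J'(2) by simp_all
    have "T.cls (J \<cdot> B) = \<one>\<^bsub>Cl K B\<^esub>" using C CJ tau_eq[OF inv] by (simp add: kernel_def)
    then have "J \<cdot> B \<in> T.Prin" using T.cls_eq_one_iff[OF ext_invertible[OF inv]] by simp
    then obtain t where "unit_mod B t" "t \<noteq> \<zero>" "J = contraction t"
      by (rule comaximal_principal_ext[OF inv J(2,3)])
    then show "C \<in> seq_sigma K TB R ` carrier QT" unfolding sigma_image CJ by blast
  qed
qed

lemma kernel_pi: "kernel (Cl K B) (singleton_group ()) seq_pi = carrier (Cl K B)"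
  by (simp add: kernel_def)

lemma exact_at_Cl_T:
  assumes rep: "\<And>C. C \<in> carrier (Cl K B) \<Longrightarrow> \<exists>L\<in>C. L \<subseteq> B \<and> comaximal TB L I"
  shows "seq_tau K TB ` carrier (Cl K R) = carrier (Cl K B)"
proof
  show "seq_tau K TB ` carrier (Cl K R) \<subseteq> carrier (Cl K B)"
    using group_hom.hom_closed[OF tau_hom] by blast
  show "carrier (Cl K B) \<subseteq> seq_tau K TB ` carrier (Cl K R)"
  proof
    fix C assume C: "C \<in> carrier (Cl K B)"
    obtain L where L: "L \<in> C" "L \<subseteq> B" "comaximal TB L I" using rep[OF C] by blast
    obtain L' where L': "invertible_ideal K B L'" "C = T.cls L'" using C by (auto simp: T.carrier_Cl)
    have inv: "invertible_ideal K B L" and CL: "C = T.cls L"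
      using T.mem_cls(1,2)[OF L'(1)] L(1) L'(2) by simp_all
    note con = comaximal_contraction_invertible[OF inv L(2,3)]
    have "C = seq_tau K TB (S.cls (L \<inter> R))" using tau_eq[OF con(1)] con(2) CL by simp
    then show "C \<in> seq_tau K TB ` carrier (Cl K R)" using S.cls_closed[OF con(1)] by blast
  qed
qed

lemma exact:
  assumes "\<And>C. C \<in> kernel (Cl K R) (Cl K B) (seq_tau K TB) \<Longrightarrow> \<exists>J\<in>C. J \<subseteq> R \<and> comaximal SR J I"
    and "\<And>C. C \<in> carrier (Cl K B) \<Longrightarrow> \<exists>L\<in>C. L \<subseteq> B \<and> comaximal TB L I"
  shows "seq_exact K TB R"
proof -
  note * = exact_at_units exact_at_product exact_at_quotient_units exact_at_Cl[OF assms(1)]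
    exact_at_Cl_T[OF assms(2)]
  show ?thesis
    unfolding seq_exact_def Let_def using * by (simp add: kernel_pi)
qed

lemma locally_associated_iff:
  "locally_associated_subring TB R \<longleftrightarrow>
    (\<forall>t. unit_mod B t \<longrightarrow> (\<exists>u\<in>Units TB. \<exists>r. unit_mod R r \<and> t = u \<otimes> r))"
proof -
  have *: "(\<exists>r\<in>R. comaximal SR (S.principal r) I \<and> (\<exists>u\<in>Units TB. t = r \<otimes> u)) \<longleftrightarrow>
      (\<exists>u\<in>Units TB. \<exists>r. unit_mod R r \<and> t = u \<otimes> r)" for t
  proof -
    have "r \<otimes> u = u \<otimes> r" if "r \<in> R" "u \<in> Units TB" for r u
      using that by (simp add: T.Units_iff m_comm)
    then show ?thesis using comaximal_S_iff unit_mod_mem[of R] by metis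
  qed
  have "locally_associated_subring TB R \<longleftrightarrow> (\<forall>t\<in>B. comaximal TB (T.principal t) I \<longrightarrow>
      (\<exists>r\<in>R. comaximal SR (S.principal r) I \<and> (\<exists>u\<in>Units TB. t = r \<otimes> u)))"
    by (simp add: locally_associated_subring_def)
  also have "\<dots> \<longleftrightarrow> (\<forall>t\<in>B. unit_mod B t \<longrightarrow> (\<exists>u\<in>Units TB. \<exists>r. unit_mod R r \<and> t = u \<otimes> r))"
    unfolding * by (simp add: comaximal_T_iff)
  finally show ?thesis using unit_mod_mem[of B] by blast
qed

text \<open>Exactness turns \<open>\<tau>\<close> being an isomorphism into the vanishing of its kernel, the set of classes of
  contracted ideals \<open>tB \<inter> R\<close>; these vanish exactly for the products \<open>ur\<close>.\<close>

lemma locally_associated_iff_iso: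
  assumes "seq_exact K TB R"
  shows "locally_associated_subring TB R \<longleftrightarrow> seq_tau K TB \<in> iso (Cl K R) (Cl K B)"
proof -
  have ker: "kernel (Cl K R) (Cl K B) (seq_tau K TB) = {S.cls (contraction t) | t. unit_mod B t \<and> t \<noteq> \<zero>}"
    using assms unfolding seq_exact_def Let_def sigma_image[symmetric] by simp
  have sur: "seq_tau K TB ` carrier (Cl K R) = carrier (Cl K B)"
    using assms unfolding seq_exact_def Let_def by (simp add: kernel_pi)
  have zero: "\<exists>u\<in>Units TB. \<exists>r. unit_mod R r \<and> \<zero> = u \<otimes> r" if "unit_mod B \<zero>"
  proof -
    have "unit_mod R \<zero>"
      using zero_unit_mod[OF that] S.D(2) by (intro unit_modI[of _ _ \<zero> \<one>]) simp_all
    then show ?thesis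
      using T.D(3) by (intro bexI[of _ \<one>] exI[of _ \<zero>]) (auto simp: T.Units_iff)
  qed
  have "seq_tau K TB \<in> iso (Cl K R) (Cl K B) \<longleftrightarrow>
      kernel (Cl K R) (Cl K B) (seq_tau K TB) \<subseteq> {\<one>\<^bsub>Cl K R\<^esub>}"
    using group_hom.iso_iff[OF tau_hom] sur by (auto simp: kernel_def)
  also have "\<dots> \<longleftrightarrow> (\<forall>t. unit_mod B t \<longrightarrow> t \<noteq> \<zero> \<longrightarrow> S.cls (contraction t) = \<one>\<^bsub>Cl K R\<^esub>)"
    unfolding ker by blast
  also have "\<dots> \<longleftrightarrow> (\<forall>t. unit_mod B t \<longrightarrow> t \<noteq> \<zero> \<longrightarrow> (\<exists>u\<in>Units TB. \<exists>r. unit_mod R r \<and> t = u \<otimes> r))"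
    using contraction_principal_iff by simp
  also have "\<dots> \<longleftrightarrow> locally_associated_subring TB R"
    unfolding locally_associated_iff using zero by blast
  finally show ?thesis by simp
qed

end

section \<open>The theorem\<close>

text \<open>The operations of \<open>T\<close> are those of \<open>K\<close>, and so are the negatives of elements of \<open>R\<close>, by uniqueness.\<close>

lemma domain_extensionI:
  assumes "is_quotient_field K T" and "subring R T"
  shows "domain_extension K R (carrier T)" and "T = K\<lparr>carrier := carrier T\<rparr>"
proof -
  have K: "field K" and sT: "subring (carrier T) K" and T: "T = K\<lparr>carrier := carrier T\<rparr>"
    and fr: "carrier K = fractions K (carrier T)"
    using assms(1) unfolding is_quotient_field_def by blast+
  interpret K: field K by fact
  show "T = K\<lparr>carrier := carrier T\<rparr>" by (rule T)
  have ops: "x \<oplus>\<^bsub>T\<^esub> y = x \<oplus>\<^bsub>K\<^esub> y" "x \<otimes>\<^bsub>T\<^esub> y = x \<otimes>\<^bsub>K\<^esub> y" "\<one>\<^bsub>T\<^esub> = \<one>\<^bsub>K\<^esub>" "\<zero>\<^bsub>T\<^esub> = \<zero>\<^bsub>K\<^esub>" for x y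
    by (subst T, simp)+
  interpret T: ring T by (subst T, rule K.subring_is_ring[OF sT])
  note R = subringE[OF assms(2)]
  have sub: "carrier T \<subseteq> carrier K" using subringE(1)[OF sT] .
  have "subring R K"
  proof (rule K.subringI)
    show "R \<subseteq> carrier K" using R(1) sub by blast
    show "\<one>\<^bsub>K\<^esub> \<in> R" using R(3) ops by simp
    show "\<ominus>\<^bsub>K\<^esub> h \<in> R" if h: "h \<in> R" for h
    proof -
      have hT: "h \<in> carrier T" using h R(1) by blast
      have "\<ominus>\<^bsub>T\<^esub> h \<oplus>\<^bsub>K\<^esub> h = \<zero>\<^bsub>K\<^esub>" using T.l_neg[OF hT] ops by simp
      then have "\<ominus>\<^bsub>K\<^esub> h = \<ominus>\<^bsub>T\<^esub> h"
        by (rule K.minus_equality) (use hT T.a_inv_closed[OF hT] sub in blast)+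
      then show ?thesis using R(5)[OF h] by simp
    qed
    show "h \<otimes>\<^bsub>K\<^esub> h' \<in> R" "h \<oplus>\<^bsub>K\<^esub> h' \<in> R" if "h \<in> R" "h' \<in> R" for h h'
      using R(6,7)[OF that] ops by simp_all
  qed
  then show "domain_extension K R (carrier T)"
    using K sT R(1) fr by (simp add: domain_extension_def domain_extension_axioms_def)
qed

theorem theorem2p10:
  fixes T K :: "'a ring" and R I :: "'a set"
  assumes "domain T" and "is_quotient_field K T"
    and "subring R T" and "I = conductor T R"
  shows "seq_well_defined K T R \<and> seq_homs K T R \<and>
         ((\<forall>C\<in>kernel (Cl K R) (Cl K (carrier T)) (seq_tau K T).
             \<exists>J\<in>C. J \<subseteq> R \<and> comaximal (T\<lparr>carrier := R\<rparr>) J I) \<and>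
          (\<forall>C\<in>carrier (Cl K (carrier T)).
             \<exists>J\<in>C. J \<subseteq> carrier T \<and> comaximal T J I)
          \<longrightarrow> seq_exact K T R) \<and>
         (seq_exact K T R \<longrightarrow>
            (locally_associated_subring T R \<longleftrightarrow>
             seq_tau K T \<in> iso (Cl K R) (Cl K (carrier T))))"
proof -
  interpret domain_extension K R "carrier T"
    by (rule domain_extensionI(1)[OF assms(2,3)])
  have T: "K\<lparr>carrier := carrier T\<rparr> = T"
    using domain_extensionI(2)[OF assms(2,3)] by (rule sym)
  have S: "K\<lparr>carrier := R\<rparr> = T\<lparr>carrier := R\<rparr>"
    using arg_cong[OF T, of "\<lambda>A. A\<lparr>carrier := R\<rparr>"] by simp
  note facts = well_defined homs exact locally_associated_iff_iso
  note facts' = facts[unfolded T S]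
  show ?thesis
    unfolding assms(4) using facts' by blast
qed

end
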